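(* Let $G$ be a non-trivial countable amenable ICC group, and let $\nu$ and $\tau$ be obtained by the construction described in the context. Then the $\sigma$-subalgebra generated by the map $\tau$ coincides, up to sets of measure zero, with the tail $\sigma$-subalgebra $\partial(G,\nu)=\bigcap_j\sigma(Z_j,Z_{j+1},\dots)$ of the $\nu$-random walk $Z_i=X_1\cdots X_i$ (with $X_i$ i.i.d. of law $\nu$).
   Context: ICC: every non-trivial element has infinite conjugacy class. $\mathbb N=\{1,2,\dots\}$. For subsets of $G$, $AB$ is the product set, $A^n=A\cdots A$ ($n$ factors), $A^{-1}=\{a^{-1}:a\in A\}$. A finite set $F\subset G$ is $(A,\delta)$-invariant if $|aF\setminus F|<\delta|F|$ for all $a\in A$. For finite $A\subset G$, an element $b$ is an $A$-lock if for all $a_1',a_2',a_1'',a_2''\in A$, $a_1'ba_2'=a_1''ba_2''$ implies $a_1'=a_1''$ and $a_2'=a_2''$, and moreover $A\cap AbA=\varnothing$. In a non-trivial ICC group every finite set $A$ admits an $A$-lock. Construction of $\nu$. Let $(c_i)_{i\in\mathbb N}$ be any sequence enumerating all elements of $G$. Put $A_1=\{e\}$ and, inductively for $i\ge1$: choose a finite $F_i\subset G$ that is $((A_i\cup\{c_i\}\cup\{c_i^{-1}\})^{i+1},1/i)$-invariant; put $D_i=F_i^{-1}\cup F_i\cup A_i\cup\{c_i\}\cup\{c_i^{-1}\}$; choose $b_i$ to be a $D_i^{10i+10}$-lock; put $A_{i+1}=D_i\cup b_iF_i^{-1}\cup F_ib_i^{-1}$. Let $K$ be $\mathbb N$-valued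 with $P(K=k)=\frac1ck^{-5/4}$, $c=\sum_k k^{-5/4}$; given $K=k$ let $Y=\text{red}$ with probability $2^{-k}$ and $Y=\text{blue}$ with probability $1-2^{-k}$. Given $K=i$: if $Y=\text{red}$ set $X=c_i$; if $Y=\text{blue}$ let $X$ be uniformly distributed on $b_iF_i^{-1}$. Then $\nu$ is the law of $X$; it has full support $G$. For $n\in\mathbb N$ let $W_n=A_n^{n+1}b_nF_n^{-1}A_n^n$ and $W_n'=A_n^nb_nF_n^{-1}A_n^n$; let $W_0=G\setminus\bigcup_{i\in\mathbb N}W_i$. The sets $W_i$ are pairwise disjoint and $W_n'\subset W_n$; $\mathrm{rk}(\gamma)$ is the unique $i\ge0$ with $\gamma\in W_i$. The map $p:\bigcup_{n\in\mathbb N}W_n\to G$, $p(q'b_nf^{-1}q'')=q'$ for $q'\in A_n^{n+1}$, $q''\in A_n^n$, $f\in F_n$, is well defined and $\mathrm{rk}(p(\gamma))<\mathrm{rk}(\gamma)$ whenever $\mathrm{rk}(\gamma)>0$. For $\gamma\in G$ let $m\ge0$ be smallest with $p^m(\gamma)\in W_0$ and put $t(\gamma)=(p^m(\gamma),\dots,p^2(\gamma),p(\gamma))$, a finite sequence of length $m$ (empty if $\gamma\in W_0$). For sequences, $\sigma_1\subset\sigma_2$ means $\sigma_1$ is an initial segment of $\sigma_2$ (possibly equal), and $\sigma\sqcup s$ is $\sigma$ with $s$ appended. For almost every trajectory $(z_i)_{i\ge1}$ there is $N$ such that: for every $i>N$, $z_i\in W_j'$ for some $j\in\mathbb N$; for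 every $i>N$, $t(z_{i+1})=t(z_i)$ or $t(z_{i+1})=t(z_i)\sqcup z_i$; hence $t(z_i)\subset t(z_j)$ for $N<i<j$; and the lengths of $t(z_i)$ are unbounded. For such trajectories define $\tau((z_i)_{i\ge1})=\bigcup_{i>N}t(z_i)\in G^{\mathbb N}$, the infinite sequence of which all $t(z_i)$, $i>N$, are initial segments (independent of the choice of $N$). So $\tau$ is an a.e. defined measurable map on $\Omega=G^{\mathbb N}$, equipped with the law $\mu$ of $(Z_i)$, with values in $G^{\mathbb N}$. The subalgebra generated by a map is the smallest $\sigma$-algebra making it measurable. *)

theory Defs
  imports "HOL-Probability.Probability" "HOL-Algebra.Coset"
begin

section \<open>Groups\<close>

definition icc_group :: "('a, 'm) monoid_scheme \<Rightarrow> bool" where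
  "icc_group G \<longleftrightarrow>
     (\<forall>x \<in> carrier G - {\<one>\<^bsub>G\<^esub>}. infinite {g \<otimes>\<^bsub>G\<^esub> x \<otimes>\<^bsub>G\<^esub> inv\<^bsub>G\<^esub> g | g. g \<in> carrier G})"

text \<open>Amenability of a discrete group: there is a left-invariant finitely additive
  probability measure defined on all subsets of the group.\<close>

definition amenable_group :: "('a, 'm) monoid_scheme \<Rightarrow> bool" where
  "amenable_group G \<longleftrightarrow>
     (\<exists>m :: 'a set \<Rightarrow> real.
        (\<forall>S. S \<subseteq> carrier G \<longrightarrow> 0 \<le> m S) \<and>
        m (carrier G) = 1 \<and>
        (\<forall>S T. S \<subseteq> carrier G \<longrightarrow> T \<subseteq> carrier G \<longrightarrow> S \<inter> T = {} \<longrightarrow> m (S \<union> T) = m S + m T) \<and>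
        (\<forall>g S. g \<in> carrier G \<longrightarrow> S \<subseteq> carrier G \<longrightarrow> m (g <#\<^bsub>G\<^esub> S) = m S))"

primrec set_pow :: "('a, 'm) monoid_scheme \<Rightarrow> 'a set \<Rightarrow> nat \<Rightarrow> 'a set" where
  "set_pow G S 0 = {\<one>\<^bsub>G\<^esub>}"
| "set_pow G S (Suc n) = set_pow G S n <#>\<^bsub>G\<^esub> S"

text \<open>The strict inequality forces \<open>F\<close> to be non-empty as soon as \<open>S\<close> is non-empty.\<close>

definition invariant_set :: "('a, 'm) monoid_scheme \<Rightarrow> 'a set \<Rightarrow> real \<Rightarrow> 'a set \<Rightarrow> bool" where
  "invariant_set G S \<delta> F \<longleftrightarrow>
     finite F \<and> F \<subseteq> carrier G \<and>
     (\<forall>a\<in>S. real (card ((a <#\<^bsub>G\<^esub> F) - F)) < \<delta> * real (card F))"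

definition is_lock :: "('a, 'm) monoid_scheme \<Rightarrow> 'a set \<Rightarrow> 'a \<Rightarrow> bool" where
  "is_lock G S b \<longleftrightarrow>
     b \<in> carrier G \<and>
     (\<forall>a1'\<in>S. \<forall>a2'\<in>S. \<forall>a1''\<in>S. \<forall>a2''\<in>S.
        a1' \<otimes>\<^bsub>G\<^esub> b \<otimes>\<^bsub>G\<^esub> a2' = a1'' \<otimes>\<^bsub>G\<^esub> b \<otimes>\<^bsub>G\<^esub> a2'' \<longrightarrow> a1' = a1'' \<and> a2' = a2'') \<and>
     S \<inter> (S <#>\<^bsub>G\<^esub> {b} <#>\<^bsub>G\<^esub> S) = {}"

section \<open>Coincidence of families of sets up to null sets\<close>

definition equal_mod_null :: "'w measure \<Rightarrow> 'w set set \<Rightarrow> 'w set set \<Rightarrow> bool" where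
  "equal_mod_null M \<A> \<B> \<longleftrightarrow>
     (\<forall>S\<in>\<A>. \<exists>T\<in>\<B>. sym_diff S T \<in> null_sets M) \<and>
     (\<forall>T\<in>\<B>. \<exists>S\<in>\<A>. sym_diff S T \<in> null_sets M)"

section \<open>The law of the index \<open>K\<close>\<close>

definition K_const :: real where
  "K_const = (\<Sum>k. real (Suc k) powr (-5/4))"

definition K_pmf :: "nat pmf" where
  "K_pmf = embed_pmf (\<lambda>k. if k = 0 then 0 else real k powr (-5/4) / K_const)"

lemma K_summable: "summable (\<lambda>k. real (Suc k) powr (-5/4))"
  using summable_real_powr_iff[of "-5/4"]
  by (subst summable_Suc_iff[of "\<lambda>n. real n powr (-5/4)"]) simp

lemma K_const_pos: "K_const > 0"
  unfolding K_const_def by (rule suminf_pos[OF K_summable]) simp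

lemma pmf_K: "pmf K_pmf k = (if k = 0 then 0 else real k powr (-5/4) / K_const)"
proof -
  let ?f = "\<lambda>k::nat. if k = 0 then 0 else real k powr (-5/4) / K_const"
  have nn: "0 \<le> ?f k" for k
    using K_const_pos by auto
  have "(\<lambda>k. real (Suc k) powr (-5/4) / K_const) sums (K_const / K_const)"
    unfolding K_const_def by (intro sums_divide summable_sums K_summable)
  then have "(\<lambda>k. ?f (Suc k)) sums 1"
    using K_const_pos by simp
  then have sums: "?f sums 1"
    using sums_Suc_imp[of ?f 1] by simp
  have "(\<integral>\<^sup>+ k. ennreal (?f k) \<partial>count_space UNIV) = (\<Sum>k. ennreal (?f k))"
    by (rule nn_integral_count_space_nat)
  also have "\<dots> = ennreal (\<Sum>k. ?f k)"
    using sums_summable[OF sums] nn by (intro suminf_ennreal2) auto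
  also have "\<dots> = 1"
    using sums_unique[OF sums] by simp
  finally show ?thesis
    unfolding K_pmf_def by (intro pmf_embed_pmf nn) auto
qed

section \<open>The construction\<close>

text \<open>All sequences are indexed by the positive integers; the values at index \<open>0\<close> play no role.\<close>

locale walk_data = group G for G :: "('a, 'm) monoid_scheme" (structure) +
  fixes c :: "nat \<Rightarrow> 'a" and F :: "nat \<Rightarrow> 'a set" and b :: "nat \<Rightarrow> 'a"
begin

primrec A :: "nat \<Rightarrow> 'a set" where
  "A 0 = {\<one>}"
| "A (Suc i) =
     (if i = 0 then {\<one>}
      else (set_inv (F i) \<union> F i \<union> A i \<union> {c i, inv (c i)})
           \<union> (b i <# set_inv (F i)) \<union> (F i #> inv (b i)))"

definition D :: "nat \<Rightarrow> 'a set" where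
  "D i = set_inv (F i) \<union> F i \<union> A i \<union> {c i, inv (c i)}"

lemma A_1: "A 1 = {\<one>}"
  by simp

lemma A_step: "1 \<le> i \<Longrightarrow> A (i + 1) = D i \<union> (b i <# set_inv (F i)) \<union> (F i #> inv (b i))"
  by (simp add: D_def)

end

locale lock_construction = walk_data +
  assumes c_enum: "c ` {1..} = carrier G"
    and F_invariant:
      "\<And>i. 1 \<le> i \<Longrightarrow> invariant_set G (set_pow G (A i \<union> {c i, inv (c i)}) (i + 1)) (1 / real i) (F i)"
    and b_lock: "\<And>i. 1 \<le> i \<Longrightarrow> is_lock G (set_pow G (D i) (10 * i + 10)) (b i)"
begin

text \<open>The Boolean \<open>red\<close> is the colour \<open>Y\<close>.\<close>

definition nu :: "'a pmf" where
  "nu =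
     bind_pmf K_pmf (\<lambda>i. bind_pmf (bernoulli_pmf ((1/2) ^ i)) (\<lambda>red.
       if red then return_pmf (c i) else pmf_of_set (b i <# set_inv (F i))))"

text \<open>A \<open>pmf\<close> lives on the whole type, so it is restricted to the group.\<close>

definition nu_measure :: "'a measure" where
  "nu_measure = restrict_space (measure_pmf nu) (carrier G)"

section \<open>The random walk and its tail\<close>

definition increments :: "(nat \<Rightarrow> 'a) measure" where
  "increments = (\<Pi>\<^sub>M i\<in>{1..}. nu_measure)"

primrec walk :: "(nat \<Rightarrow> 'a) \<Rightarrow> nat \<Rightarrow> 'a" where
  "walk x 0 = \<one>"
| "walk x (Suc n) = walk x n \<otimes> x (Suc n)"

definition path_algebra :: "(nat \<Rightarrow> 'a) measure" where
  "path_algebra = (\<Pi>\<^sub>M i\<in>{1..}. count_space (carrier G))"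

definition mu :: "(nat \<Rightarrow> 'a) measure" where
  "mu = distr increments path_algebra (\<lambda>x. \<lambda>i\<in>{1..}. walk x i)"

text \<open>On the path space \<open>Z\<^sub>i\<close> is the coordinate map \<open>z \<mapsto> z i\<close>. The library's tail events
  of a sequence indexed from \<open>0\<close> are taken for the sequence \<open>Z\<^sub>1, Z\<^sub>2, \<dots>\<close>.\<close>

definition tail_algebra :: "(nat \<Rightarrow> 'a) set set" where
  "tail_algebra =
     prob_space.tail_events mu
       (\<lambda>n. sets (vimage_algebra (space mu) (\<lambda>z. z (Suc n)) (count_space (carrier G))))"

section \<open>The boundary map\<close>

definition W_pos :: "nat \<Rightarrow> 'a set" where
  "W_pos n = set_pow G (A n) (n + 1) <#> {b n} <#> set_inv (F n) <#> set_pow G (A n) n"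

definition W' :: "nat \<Rightarrow> 'a set" where
  "W' n = set_pow G (A n) n <#> {b n} <#> set_inv (F n) <#> set_pow G (A n) n"

definition W0 :: "'a set" where
  "W0 = carrier G - (\<Union>i\<in>{1..}. W_pos i)"

text \<open>\<open>p\<close> is only meaningful on \<open>\<Union>i\<in>{1..}. W_pos i\<close>.\<close>

definition p :: "'a \<Rightarrow> 'a" where
  "p \<gamma> = (THE q'. \<exists>n\<ge>1. q' \<in> set_pow G (A n) (n + 1) \<and>
             (\<exists>q''\<in>set_pow G (A n) n. \<exists>f\<in>F n. \<gamma> = q' \<otimes> b n \<otimes> inv f \<otimes> q''))"

definition depth :: "'a \<Rightarrow> nat" where
  "depth \<gamma> = (LEAST m. (p ^^ m) \<gamma> \<in> W0)"

text \<open>\<open>[p\<^sup>m \<gamma>, \<dots>, p\<^sup>2 \<gamma>, p \<gamma>]\<close> with \<open>m = depth \<gamma>\<close>.\<close>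

definition t :: "'a \<Rightarrow> 'a list" where
  "t \<gamma> = rev (map (\<lambda>k. (p ^^ k) \<gamma>) [1..<depth \<gamma> + 1])"

definition good_from :: "(nat \<Rightarrow> 'a) \<Rightarrow> nat \<Rightarrow> bool" where
  "good_from z N \<longleftrightarrow>
     (\<forall>i>N. \<exists>j\<ge>1. z i \<in> W' j) \<and>
     (\<forall>i>N. t (z (i + 1)) = t (z i) \<or> t (z (i + 1)) = t (z i) @ [z i]) \<and>
     (\<forall>L. \<exists>i>N. L \<le> length (t (z i)))"

text \<open>\<open>initial_segment \<sigma> s\<close>: the list \<open>\<sigma>\<close> is an initial segment of the infinite
  sequence \<open>s 1, s 2, \<dots>\<close>\<close>

definition initial_segment :: "'a list \<Rightarrow> (nat \<Rightarrow> 'a) \<Rightarrow> bool" where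
  "initial_segment \<sigma> s \<longleftrightarrow> (\<forall>k<length \<sigma>. \<sigma> ! k = s (k + 1))"

text \<open>The almost everywhere defined map is made total by a constant value on the remaining
  (measurable, null) set of trajectories; up to null sets the generated \<open>\<sigma>\<close>-algebra does not
  depend on this value.\<close>

definition tau :: "(nat \<Rightarrow> 'a) \<Rightarrow> (nat \<Rightarrow> 'a)" where
  "tau z =
     (if \<exists>N. good_from z N
      then (THE s. s \<in> space path_algebra \<and>
              (\<exists>N. good_from z N \<and> (\<forall>i>N. initial_segment (t (z i)) s)))
      else (\<lambda>i\<in>{1..}. \<one>))"

definition tau_algebra :: "(nat \<Rightarrow> 'a) set set" where
  "tau_algebra = sets (vimage_algebra (space mu) tau path_algebra)"

section \<open>Well-definedness of the walk\<close>

lemma F_props: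
  assumes "1 \<le> i" shows "finite (F i)" "F i \<subseteq> carrier G" "F i \<noteq> {}"
proof -
  have inv: "invariant_set G (set_pow G (A i \<union> {c i, inv (c i)}) (i + 1)) (1 / real i) (F i)"
    using F_invariant assms by simp
  then show "finite (F i)" "F i \<subseteq> carrier G"
    by (auto simp: invariant_set_def)
  have "set_pow G (A i \<union> {c i, inv (c i)}) n \<noteq> {}" for n
    by (induction n) (auto simp: set_mult_def)
  then obtain a where "a \<in> set_pow G (A i \<union> {c i, inv (c i)}) (i + 1)"
    by blast
  with inv show "F i \<noteq> {}"
    unfolding invariant_set_def by force
qed

lemma set_pmf_nu: "set_pmf nu \<subseteq> carrier G"
proof
  fix x assume "x \<in> set_pmf nu"
  then obtain i red where i: "i \<in> set_pmf K_pmf"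
    and x: "x \<in> set_pmf (if red then return_pmf (c i) else pmf_of_set (b i <# set_inv (F i)))"
    by (auto simp: nu_def)
  have i1: "1 \<le> i"
    using i by (auto simp: set_pmf_iff pmf_K split: if_splits)
  have fin: "finite (b i <# set_inv (F i))" and ne: "b i <# set_inv (F i) \<noteq> {}"
    using F_props[OF i1] by (auto simp: l_coset_def SET_INV_def)
  have "b i \<in> carrier G"
    using b_lock[OF i1] by (simp add: is_lock_def)
  then have "b i <# set_inv (F i) \<subseteq> carrier G"
    using F_props[OF i1] by (auto simp: l_coset_def SET_INV_def)
  moreover have "c i \<in> carrier G"
    using c_enum i1 by auto
  ultimately show "x \<in> carrier G"
    using x fin ne by (auto split: if_splits)
qed

lemma space_nu_measure: "space nu_measure = carrier G"
  by (simp add: nu_measure_def space_restrict_space)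

lemma sets_nu_measure: "sets nu_measure = sets (count_space (carrier G))"
  by (auto simp: nu_measure_def sets_restrict_space)

lemma prob_space_nu_measure: "prob_space nu_measure"
proof
  have "emeasure (measure_pmf nu) (carrier G) = emeasure (measure_pmf nu) (set_pmf nu)"
    using set_pmf_nu by (intro emeasure_eq_AE) (auto simp: AE_measure_pmf_iff)
  then show "emeasure nu_measure (space nu_measure) = 1"
    by (simp add: nu_measure_def emeasure_restrict_space space_restrict_space
        measure_pmf.emeasure_eq_1_AE AE_measure_pmf_iff)
qed

lemma walk_measurable:
  "(\<lambda>x. \<lambda>i\<in>{1..}. walk x i) \<in> increments \<rightarrow>\<^sub>M path_algebra"
proof -
  have sets: "sets increments = sets path_algebra"
    unfolding increments_def path_algebra_def by (intro sets_PiM_cong refl sets_nu_measure)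
  have carr: "walk x n \<in> carrier G" if "x \<in> space path_algebra" for x n
    using that by (induction n) (auto simp: path_algebra_def space_PiM PiE_def Pi_def)
  have fin: "(\<lambda>x. walk x n) \<in> path_algebra \<rightarrow>\<^sub>M count_space (carrier G)" for n
  proof (induction n)
    case (Suc n)
    have X: "(\<lambda>x. x (Suc n)) \<in> path_algebra \<rightarrow>\<^sub>M count_space (carrier G)"
      unfolding path_algebra_def by (rule measurable_component_singleton) simp
    have "countable (carrier G)"
      using c_enum by (metis countable_image countableI_type)
    from measurable_compose_countable'[OF _ Suc.IH this, of "\<lambda>g x. g \<otimes> x (Suc n)"]
    show ?case
      using measurable_compose[OF X, of "\<lambda>h. g \<otimes> h" "count_space (carrier G)" for g] by auto
  qed simp
  have "(\<lambda>x. \<lambda>i\<in>{1..}. walk x i) \<in> path_algebra \<rightarrow>\<^sub>M path_algebra"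
    unfolding path_algebra_def
    by (rule measurable_restrict) (use fin in \<open>simp add: path_algebra_def\<close>)
  then show ?thesis
    using measurable_cong_sets[OF sets refl] by blast
qed

lemma prob_space_mu: "prob_space mu"
proof -
  have "prob_space increments"
    unfolding increments_def by (rule prob_space_PiM) (rule prob_space_nu_measure)
  then show ?thesis
    unfolding mu_def by (rule prob_space.prob_space_distr) (rule walk_measurable)
qed

end

end

theory Submission
  imports Defs "HOL-Real_Asymp.Real_Asymp"
begin

text \<open>
  The trajectory of the walk enters \<open>\<tau>\<close> through its records. If among the first \<open>i\<close> increments
  exactly one, say the \<open>m\<close>-th, lies in \<open>b\<^sub>k F\<^sub>k\<inverse>\<close>, all the others lie in \<open>A\<^sub>k\<close>, and
  \<open>i \<le> k\<close>, then the lock property reads off from \<open>Z\<^sub>i\<close> the position \<open>p (Z\<^sub>i) = Z\<^sub>m\<^sub>-\<^sub>1\<close> of the walk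
  just before this increment. So every entry of \<open>\<tau>\<close> far enough out is a position of the walk,
  visited at a time that tends to infinity with the index of the entry
  (\<open>peak_position\<close>, \<open>peaks_imp_good\<close>, \<open>tau_entries_are_positions\<close>).
  That almost every trajectory has such a dominating increment at all large times is a
  Borel-Cantelli argument: the index \<open>K\<close> has tail of order \<open>n\<^sup>-\<^sup>1\<^sup>/\<^sup>4\<close>, so the largest of \<open>n\<close> indices is
  eventually at least \<open>n\<close>, it is red with probability at most \<open>2\<^sup>-\<^sup>n\<close>, and it ties with an earlier
  one with probability of order \<open>n\<^sup>-\<^sup>5\<^sup>/\<^sup>4\<close> (\<open>AE_good\<close>).

  Since \<open>\<tau>\<close> can be computed from the positions after any given time, its events are tail events
  (\<open>tau_algebra_subset_tail\<close>).

  Conversely let \<open>T\<close> be a tail event and let \<open>h\<^sub>n(g)\<close> be the conditional probability of \<open>T\<close> given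
  \<open>Z\<^sub>n = g\<close>. This is a bounded space-time harmonic function, and because the identity is an increment of
  positive probability it does not depend on \<open>n\<close> (\<open>tail_prob_constant_in_time\<close>). By martingale
  convergence \<open>h(Z\<^sub>n)\<close> tends to the indicator of \<open>T\<close> almost surely; only the position enters here, not
  the time. Hence \<open>h\<close> evaluated along the entries of \<open>\<tau>\<close>, which are positions at later and later
  times, has the same limit, and this limit is a function of \<open>\<tau>\<close> (\<open>tail_event_recovered\<close>).
\<close>

section \<open>Powers of subsets of a group\<close>

declare set_pow.simps(2) [simp del]

context group
begin

lemma set_pow_Suc: "x \<in> set_pow G S (Suc n) \<longleftrightarrow> (\<exists>u\<in>set_pow G S n. \<exists>v\<in>S. x = u \<otimes> v)"
  by (auto simp: set_pow.simps(2) set_mult_def)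

lemma set_pow_closed: "S \<subseteq> carrier G \<Longrightarrow> set_pow G S n \<subseteq> carrier G"
  by (induction n) (auto simp: set_pow_Suc subset_iff)

lemma one_in_set_pow: "\<one> \<in> S \<Longrightarrow> \<one> \<in> set_pow G S n"
  by (induction n) (force simp: set_pow_Suc)+

lemma set_pow_mult:
  assumes S: "S \<subseteq> carrier G" and x: "x \<in> set_pow G S m" and y: "y \<in> set_pow G S n"
  shows "x \<otimes> y \<in> set_pow G S (m + n)"
  using y
proof (induction n arbitrary: y)
  case 0
  then show ?case using x set_pow_closed[OF S, of m] by auto
next
  case (Suc n)
  then obtain u v where uv: "u \<in> set_pow G S n" "v \<in> S" "y = u \<otimes> v"
    by (auto simp: set_pow_Suc)
  then have "x \<otimes> y = (x \<otimes> u) \<otimes> v"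
    using S set_pow_closed[OF S] x by (simp add: m_assoc subset_iff)
  then show ?case
    using Suc.IH[OF uv(1)] uv(2) by (auto simp: set_pow_Suc)
qed

lemma set_pow_mono:
  assumes "S \<subseteq> T" "\<one> \<in> T" "T \<subseteq> carrier G" "m \<le> n"
  shows "set_pow G S m \<subseteq> set_pow G T n"
proof -
  have 1: "set_pow G S m \<subseteq> set_pow G T m"
    using assms(1) by (induction m) (simp_all add: set_pow_Suc subset_iff, metis)
  have "x \<in> set_pow G T n" if x: "x \<in> set_pow G T m" for x
    using set_pow_mult[OF assms(3) x one_in_set_pow[OF assms(2), of "n - m"]]
      assms(4) x set_pow_closed[OF assms(3), of m] by (auto simp: subset_iff)
  with 1 show ?thesis by blast
qed

lemma in_set_pow_1: "S \<subseteq> carrier G \<Longrightarrow> x \<in> S \<Longrightarrow> x \<in> set_pow G S 1"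
  by (force simp: set_pow_Suc)

end

context lock_construction
begin

section \<open>Locks and the predecessor map\<close>

lemma b_closed: "1 \<le> n \<Longrightarrow> b n \<in> carrier G"
  using b_lock by (simp add: is_lock_def)

lemma c_closed: "1 \<le> n \<Longrightarrow> c n \<in> carrier G"
  using c_enum by auto

lemma F_closed: "1 \<le> n \<Longrightarrow> f \<in> F n \<Longrightarrow> f \<in> carrier G"
  using F_props by auto

lemma A_closed: "A n \<subseteq> carrier G"
proof (induction n)
  case (Suc n)
  then show ?case
    using F_closed[of n] b_closed[of n] c_closed[of n]
    by (auto simp: SET_INV_def l_coset_def r_coset_def)
qed simp

lemma one_in_A: "\<one> \<in> A n"
  by (induction n) auto

lemma set_pow_A_closed: "x \<in> set_pow G (A n) m \<Longrightarrow> x \<in> carrier G"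
  using set_pow_closed[OF A_closed] by blast

lemma A_mono: "m \<le> n \<Longrightarrow> A m \<subseteq> A n"
  by (rule lift_Suc_mono_le[of A]) (auto simp: one_in_A)

lemma D_closed: "1 \<le> n \<Longrightarrow> D n \<subseteq> carrier G"
  using A_closed[of n] F_closed[of n] c_closed[of n] by (auto simp: D_def SET_INV_def)

lemma A_subset_D: "A n \<subseteq> D n"
  by (auto simp: D_def)

lemma one_in_D: "\<one> \<in> D n"
  using one_in_A A_subset_D by blast

lemma A_pow_subset_D_pow: "1 \<le> n \<Longrightarrow> m \<le> k \<Longrightarrow> set_pow G (A n) m \<subseteq> set_pow G (D n) k"
  by (intro set_pow_mono A_subset_D one_in_D D_closed)

lemma F_inverse_in_D: "f \<in> F n \<Longrightarrow> inv f \<in> D n"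
  by (auto simp: D_def SET_INV_def)

lemma blue_step_in_A: "1 \<le> n \<Longrightarrow> f \<in> F n \<Longrightarrow> b n \<otimes> inv f \<in> A (Suc n)"
  by (auto simp: SET_INV_def l_coset_def)

lemma c_in_A: "1 \<le> n \<Longrightarrow> c n \<in> A (Suc n)"
  by simp

declare A.simps(2) [simp del]

lemma lock_cancel:
  assumes "1 \<le> n"
    and "u \<in> set_pow G (D n) (10 * n + 10)" "v \<in> set_pow G (D n) (10 * n + 10)"
    and "u' \<in> set_pow G (D n) (10 * n + 10)" "v' \<in> set_pow G (D n) (10 * n + 10)"
    and "u \<otimes> b n \<otimes> v = u' \<otimes> b n \<otimes> v'"
  shows "u = u'"
  using b_lock[OF assms(1)] assms(2-) unfolding is_lock_def by blast

text \<open>The two lock properties are used in this form: \<open>lock_cancel\<close> makes the predecessor map \<open>p\<close>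
  well defined, and \<open>lock_avoids\<close> separates the sets \<open>W\<^sub>n\<close> from everything built at earlier stages.\<close>

lemma lock_avoids:
  assumes "1 \<le> n"
    and "u \<in> set_pow G (D n) (10 * n + 10)" "v \<in> set_pow G (D n) (10 * n + 10)"
  shows "u \<otimes> b n \<otimes> v \<notin> set_pow G (D n) (10 * n + 10)"
proof
  assume *: "u \<otimes> b n \<otimes> v \<in> set_pow G (D n) (10 * n + 10)"
  have "u \<otimes> b n \<otimes> v \<in> set_pow G (D n) (10 * n + 10) <#> {b n} <#> set_pow G (D n) (10 * n + 10)"
    using assms(2,3) unfolding set_mult_def by blast
  with * b_lock[OF assms(1)] show False
    unfolding is_lock_def by blast
qed

lemma W_pos_iff:
  "\<gamma> \<in> W_pos n \<longleftrightarrow> (\<exists>q'\<in>set_pow G (A n) (n + 1). \<exists>q''\<in>set_pow G (A n) n. \<exists>f\<in>F n.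
     \<gamma> = q' \<otimes> b n \<otimes> inv f \<otimes> q'')"
  unfolding W_pos_def set_mult_def SET_INV_def by blast

lemma W'_iff:
  "\<gamma> \<in> W' n \<longleftrightarrow> (\<exists>q'\<in>set_pow G (A n) n. \<exists>q''\<in>set_pow G (A n) n. \<exists>f\<in>F n.
     \<gamma> = q' \<otimes> b n \<otimes> inv f \<otimes> q'')"
  unfolding W'_def set_mult_def SET_INV_def by blast

lemma W'_subset_W_pos: "W' n \<subseteq> W_pos n"
  using set_pow_mono[OF subset_refl one_in_A A_closed, of n "n + 1" n]
  unfolding W'_iff W_pos_iff subset_iff by (meson le_add1)

text \<open>The factor \<open>f\<inverse>\<close> lies in \<open>D\<^sub>n\<close>, so it can be absorbed in the right factor, and an element of \<open>W\<^sub>n\<close>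
  takes the shape \<open>u b\<^sub>n v\<close> to which the lock property applies.\<close>

lemma word_lock_form:
  assumes n: "1 \<le> n" and "q' \<in> set_pow G (A n) (n + 1)" "q'' \<in> set_pow G (A n) n" "f \<in> F n"
  shows "q' \<in> set_pow G (D n) (10 * n + 10)" "inv f \<otimes> q'' \<in> set_pow G (D n) (10 * n + 10)"
    "q' \<otimes> b n \<otimes> inv f \<otimes> q'' = q' \<otimes> b n \<otimes> (inv f \<otimes> q'')"
proof -
  show "q' \<in> set_pow G (D n) (10 * n + 10)"
    using assms(2) A_pow_subset_D_pow[OF n, of "n + 1" "10 * n + 10"] by auto
  have "inv f \<otimes> q'' \<in> set_pow G (D n) (1 + n)"
    using assms A_pow_subset_D_pow[OF n, of n n]
    by (intro set_pow_mult in_set_pow_1 D_closed F_inverse_in_D) auto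
  then show "inv f \<otimes> q'' \<in> set_pow G (D n) (10 * n + 10)"
    using set_pow_mono[OF subset_refl one_in_D D_closed[OF n], of "1 + n" "10 * n + 10"] by auto
  show "q' \<otimes> b n \<otimes> inv f \<otimes> q'' = q' \<otimes> b n \<otimes> (inv f \<otimes> q'')"
    using assms set_pow_A_closed F_closed[OF n] b_closed[OF n]
    by (intro m_assoc) auto
qed

lemma W_pos_not_in_D_pow:
  assumes "1 \<le> n" "\<gamma> \<in> W_pos n"
  shows "\<gamma> \<notin> set_pow G (D n) (10 * n + 10)"
  using assms word_lock_form[OF assms(1)] lock_avoids[OF assms(1)] unfolding W_pos_iff
  by fastforce

lemma W_pos_closed: "1 \<le> n \<Longrightarrow> W_pos n \<subseteq> carrier G"
  using set_pow_A_closed F_closed b_closed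
  by (auto simp: W_pos_iff)

text \<open>\<open>b\<^sub>m F\<^sub>m\<inverse> \<subseteq> A\<^sub>m\<^sub>+\<^sub>1\<close>, so an element of \<open>W\<^sub>m\<close> is a product of at most \<open>2m + 2\<close> elements of any later
  \<open>A\<^sub>n\<close>; this is well below the length \<open>10n + 10\<close> up to which \<open>b\<^sub>n\<close> is a lock.\<close>

lemma W_pos_in_later_pow:
  assumes "1 \<le> m" "m < n" "\<gamma> \<in> W_pos m"
  shows "\<gamma> \<in> set_pow G (D n) (10 * n + 10)"
proof -
  obtain q' q'' f where q: "q' \<in> set_pow G (A m) (m + 1)" "q'' \<in> set_pow G (A m) m" "f \<in> F m"
    "\<gamma> = q' \<otimes> b m \<otimes> inv f \<otimes> q''"
    using assms(3) unfolding W_pos_iff by blast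
  have A: "A m \<subseteq> A n" "A (Suc m) \<subseteq> A n"
    using assms by (auto intro!: A_mono)
  have q1: "q' \<in> set_pow G (A n) (m + 1)" "q'' \<in> set_pow G (A n) m"
    using q set_pow_mono[OF A(1) one_in_A A_closed] by blast+
  have q2: "b m \<otimes> inv f \<in> set_pow G (A n) 1"
    using blue_step_in_A[OF assms(1) q(3)] A(2) by (intro in_set_pow_1 A_closed) auto
  have "q' \<otimes> (b m \<otimes> inv f) \<otimes> q'' \<in> set_pow G (A n) ((m + 1 + 1) + m)"
    by (intro set_pow_mult A_closed q1 q2)
  moreover have "q' \<otimes> (b m \<otimes> inv f) \<otimes> q'' = \<gamma>"
    using q set_pow_A_closed F_closed b_closed assms(1)
    by (simp add: m_assoc)
  ultimately show ?thesis
    using A_pow_subset_D_pow[of n "(m + 1 + 1) + m" "10 * n + 10"] assms(1,2) by auto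
qed

lemma W_pos_disjoint:
  assumes "1 \<le> m" "1 \<le> n" "\<gamma> \<in> W_pos m" "\<gamma> \<in> W_pos n"
  shows "m = n"
  using W_pos_in_later_pow[of m n \<gamma>] W_pos_in_later_pow[of n m \<gamma>]
    W_pos_not_in_D_pow[of m \<gamma>] W_pos_not_in_D_pow[of n \<gamma>] assms
  by (metis linorder_neqE_nat)

lemma p_word:
  assumes "1 \<le> n" "q' \<in> set_pow G (A n) (n + 1)" "q'' \<in> set_pow G (A n) n" "f \<in> F n"
  shows "p (q' \<otimes> b n \<otimes> inv f \<otimes> q'') = q'" (is "p ?\<gamma> = q'")
  unfolding p_def
proof (rule the_equality)
  show "\<exists>n\<ge>1. q' \<in> set_pow G (A n) (n + 1) \<and>
          (\<exists>q''\<in>set_pow G (A n) n. \<exists>f\<in>F n. ?\<gamma> = q' \<otimes> b n \<otimes> inv f \<otimes> q'')"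
    using assms by blast
  fix r
  assume "\<exists>n\<ge>1. r \<in> set_pow G (A n) (n + 1) \<and>
            (\<exists>q''\<in>set_pow G (A n) n. \<exists>f\<in>F n. ?\<gamma> = r \<otimes> b n \<otimes> inv f \<otimes> q'')"
  then obtain k r'' e where r: "1 \<le> k" "r \<in> set_pow G (A k) (k + 1)" "r'' \<in> set_pow G (A k) k"
    "e \<in> F k" "?\<gamma> = r \<otimes> b k \<otimes> inv e \<otimes> r''"
    by blast
  have "?\<gamma> \<in> W_pos k" "?\<gamma> \<in> W_pos n"
    using r assms unfolding W_pos_iff by blast+
  then have "k = n"
    using W_pos_disjoint r(1) assms(1) by blast
  with r assms word_lock_form[of n] show "r = q'"
    by (intro lock_cancel[of n r "inv e \<otimes> r''" q' "inv f \<otimes> q''"]) auto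
qed

lemma p_in_pow: "1 \<le> n \<Longrightarrow> \<gamma> \<in> W_pos n \<Longrightarrow> p \<gamma> \<in> set_pow G (A n) (n + 1)"
  unfolding W_pos_iff using p_word by auto

lemma p_closed: "1 \<le> n \<Longrightarrow> \<gamma> \<in> W_pos n \<Longrightarrow> p \<gamma> \<in> carrier G"
  using p_in_pow set_pow_closed[OF A_closed] by blast

lemma p_decreases_rank:
  assumes "1 \<le> n" "\<gamma> \<in> W_pos n" "1 \<le> m" "p \<gamma> \<in> W_pos m"
  shows "m < n"
proof (rule ccontr)
  assume "\<not> m < n"
  then have "set_pow G (A n) (n + 1) \<subseteq> set_pow G (A m) (m + 1)"
    by (intro set_pow_mono A_mono one_in_A A_closed) auto
  also have "\<dots> \<subseteq> set_pow G (D m) (10 * m + 10)"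
    using assms(3) by (intro A_pow_subset_D_pow) auto
  finally show False
    using p_in_pow[OF assms(1,2)] W_pos_not_in_D_pow[OF assms(3,4)] by blast
qed

lemma W_pos_not_W0: "1 \<le> n \<Longrightarrow> \<gamma> \<in> W_pos n \<Longrightarrow> \<gamma> \<notin> W0"
  by (auto simp: W0_def)

lemma W_cases:
  assumes "\<gamma> \<in> carrier G"
  obtains "\<gamma> \<in> W0" | n where "1 \<le> n" "\<gamma> \<in> W_pos n"
  using assms by (auto simp: W0_def)

lemma p_reaches_W0: "\<gamma> \<in> carrier G \<Longrightarrow> \<exists>m. (p ^^ m) \<gamma> \<in> W0"
proof -
  have *: "\<exists>m. (p ^^ m) \<gamma> \<in> W0" if "1 \<le> n" "\<gamma> \<in> W_pos n" for n \<gamma>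
    using that
  proof (induction n arbitrary: \<gamma> rule: less_induct)
    case (less n)
    have "\<exists>m. (p ^^ m) (p \<gamma>) \<in> W0"
      using p_closed[OF less.prems]
    proof (cases rule: W_cases)
      case 1
      then show ?thesis by (intro exI[of _ 0]) simp
    next
      case (2 k)
      then show ?thesis
        using less.IH[OF p_decreases_rank] less.prems by blast
    qed
    then obtain m where "(p ^^ Suc m) \<gamma> \<in> W0"
      by (auto simp: funpow_swap1)
    then show ?case ..
  qed
  assume "\<gamma> \<in> carrier G"
  then show ?thesis
  proof (cases rule: W_cases)
    case 1
    then show ?thesis by (intro exI[of _ 0]) simp
  qed (use * in blast)
qed

lemma t_W0: "\<gamma> \<in> W0 \<Longrightarrow> t \<gamma> = []"
proof -
  assume "\<gamma> \<in> W0"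
  then have "depth \<gamma> = 0"
    unfolding depth_def by (intro Least_equality) auto
  then show ?thesis by (simp add: t_def)
qed

lemma t_W_pos:
  assumes "1 \<le> n" "\<gamma> \<in> W_pos n"
  shows "t \<gamma> = t (p \<gamma>) @ [p \<gamma>]"
proof -
  have shift: "(p ^^ k) (p \<gamma>) = (p ^^ Suc k) \<gamma>" for k
    by (simp add: funpow_swap1)
  obtain m where "(p ^^ m) \<gamma> \<in> W0"
    using p_reaches_W0 W_pos_closed assms by blast
  then have depth: "depth \<gamma> = Suc (depth (p \<gamma>))"
    unfolding depth_def shift
    by (rule Least_Suc) (use W_pos_not_W0[OF assms] in simp)
  have "[1..<depth \<gamma> + 1] = 1 # map Suc [1..<depth (p \<gamma>) + 1]"
    by (simp add: depth upt_conv_Cons map_Suc_upt del: upt_Suc)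
  moreover have "map (\<lambda>k. (p ^^ k) \<gamma>) (map Suc ks) = map (\<lambda>k. (p ^^ k) (p \<gamma>)) ks" for ks
    unfolding shift by simp
  ultimately show ?thesis
    unfolding t_def by (simp del: map_map upt_Suc map_Suc_upt)
qed

lemma t_closed: "\<gamma> \<in> carrier G \<Longrightarrow> set (t \<gamma>) \<subseteq> carrier G"
proof -
  have *: "set (t \<gamma>) \<subseteq> carrier G" if "1 \<le> n" "\<gamma> \<in> W_pos n" for n \<gamma>
    using that
  proof (induction n arbitrary: \<gamma> rule: less_induct)
    case (less n)
    have "set (t (p \<gamma>)) \<subseteq> carrier G"
      using p_closed[OF less.prems]
    proof (cases rule: W_cases)
      case (2 k)
      then show ?thesis
        using less.IH[OF p_decreases_rank] less.prems by blast
    qed (simp add: t_W0)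
    then show ?case
      using t_W_pos[OF less.prems] p_closed[OF less.prems] by simp
  qed
  assume "\<gamma> \<in> carrier G"
  then show ?thesis
    by (cases rule: W_cases) (use * t_W0 in auto)
qed

section \<open>Levels of increments and peaks of a trajectory\<close>

text \<open>An increment does not determine the index \<open>K\<close> that produced it, since the same element may be
  both some \<open>c\<^sub>i\<close> and a blue step. The level is a substitute that is a function of the increment alone:
  it equals \<open>K\<close> on blue steps (\<open>level_blue_step\<close>) and is at most \<open>K\<close> on red ones, which are rare.\<close>

definition level :: "'a \<Rightarrow> nat" where
  "level g = (LEAST k. g \<in> A (Suc k))"

definition is_blue :: "'a \<Rightarrow> bool" where
  "is_blue g \<longleftrightarrow> 1 \<le> level g \<and> g \<in> b (level g) <# set_inv (F (level g))"

lemma level_le: "g \<in> A (Suc k) \<Longrightarrow> level g \<le> k"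
  unfolding level_def by (rule Least_le)

lemma level_less:
  assumes "g \<in> carrier G" "level g < k"
  shows "g \<in> A k"
proof -
  obtain i where "1 \<le> i" "g = c i"
    using assms(1) c_enum by (metis imageE atLeast_iff)
  then have "g \<in> A (Suc i)"
    using c_in_A by blast
  then have "g \<in> A (Suc (level g))"
    unfolding level_def by (rule LeastI)
  then show ?thesis
    using A_mono[of "Suc (level g)" k] assms(2) by auto
qed

text \<open>By the lock property \<open>b\<^sub>k F\<^sub>k\<inverse>\<close> is disjoint from \<open>A\<^sub>k\<close>, so a blue step of index \<open>k\<close> first occurs in
  \<open>A\<^sub>k\<^sub>+\<^sub>1\<close>.\<close>

lemma level_blue_step:
  assumes "1 \<le> k" "g \<in> b k <# set_inv (F k)"
  shows "level g = k"
proof -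
  obtain f where f: "f \<in> F k" "g = b k \<otimes> inv f"
    using assms(2) by (auto simp: l_coset_def SET_INV_def)
  have "g = \<one> \<otimes> b k \<otimes> inv f"
    using f b_closed[OF assms(1)] F_closed[OF assms(1)] by simp
  moreover have "inv f \<in> set_pow G (D k) (10 * k + 10)"
    using word_lock_form(2)[OF assms(1) one_in_set_pow[OF one_in_A] one_in_set_pow[OF one_in_A] f(1)]
      F_closed[OF assms(1) f(1)] by simp
  ultimately have "g \<notin> set_pow G (D k) (10 * k + 10)"
    using lock_avoids[OF assms(1) one_in_set_pow[OF one_in_D]] by metis
  moreover have "A k \<subseteq> set_pow G (D k) (10 * k + 10)"
    using A_pow_subset_D_pow[OF assms(1), of 1 "10 * k + 10"] in_set_pow_1[OF A_closed, of _ k]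
    by (simp add: subset_iff)
  ultimately have "g \<notin> A k"
    by blast
  moreover have "g \<in> carrier G"
    using f b_closed[OF assms(1)] F_closed[OF assms(1)] by simp
  ultimately have "k \<le> level g"
    using level_less by (metis linorder_not_le)
  moreover have "level g \<le> k"
    using f blue_step_in_A[OF assms(1)] level_le by blast
  ultimately show ?thesis by simp
qed

text \<open>The increments are reindexed from zero: \<open>\<omega> j\<close> is the increment \<open>X\<^sub>j\<^sub>+\<^sub>1\<close>, and \<open>pos \<omega> m\<close> is the
  position immediately before the increment \<open>\<omega> m\<close>.\<close>

primrec pos :: "(nat \<Rightarrow> 'a) \<Rightarrow> nat \<Rightarrow> 'a" where
  "pos \<omega> 0 = \<one>"
| "pos \<omega> (Suc n) = pos \<omega> n \<otimes> \<omega> n"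

lemma pos_closed: "(\<And>j. \<omega> j \<in> carrier G) \<Longrightarrow> pos \<omega> n \<in> carrier G"
  by (induction n) auto

lemma pos_add:
  assumes "\<And>j. \<omega> j \<in> carrier G"
  shows "pos \<omega> (m + n) = pos \<omega> m \<otimes> pos (\<lambda>j. \<omega> (m + j)) n"
proof (induction n)
  case (Suc n)
  then show ?case
    using assms pos_closed[of \<omega> m] pos_closed[of "\<lambda>j. \<omega> (m + j)" n] by (simp add: m_assoc)
qed (use assms pos_closed[of \<omega> m] in simp)

lemma pos_in_set_pow: "(\<And>j. j < n \<Longrightarrow> \<omega> j \<in> S) \<Longrightarrow> pos \<omega> n \<in> set_pow G S n"
  by (induction n) (auto simp: set_pow_Suc)

text \<open>The increment \<open>\<omega> m\<close> dominates the first \<open>i\<close> ones. The bound \<open>i \<le> level (\<omega> m)\<close> limits the number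
  of factors before and after it, so that these products lie in the powers of \<open>A\<close> allowed in \<open>W'\<close>.\<close>

definition peak :: "(nat \<Rightarrow> 'a) \<Rightarrow> nat \<Rightarrow> nat \<Rightarrow> bool" where
  "peak \<omega> i m \<longleftrightarrow> m < i \<and> i \<le> level (\<omega> m) \<and> is_blue (\<omega> m) \<and>
     (\<forall>j<i. j \<noteq> m \<longrightarrow> level (\<omega> j) < level (\<omega> m))"

lemma peak_position:
  assumes \<omega>: "\<And>j. \<omega> j \<in> carrier G" and pk: "peak \<omega> i m"
  shows "pos \<omega> i \<in> W' (level (\<omega> m))" "p (pos \<omega> i) = pos \<omega> m"
proof -
  let ?k = "level (\<omega> m)"
  have k: "1 \<le> ?k" "m < i" "i \<le> ?k"
    using pk by (auto simp: peak_def is_blue_def)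
  obtain f where f: "f \<in> F ?k" "\<omega> m = b ?k \<otimes> inv f"
    using pk by (auto simp: peak_def is_blue_def l_coset_def SET_INV_def)
  have small: "\<omega> j \<in> A ?k" if "j < i" "j \<noteq> m" for j
    using that pk \<omega> by (intro level_less) (auto simp: peak_def)
  have pre: "pos \<omega> m \<in> set_pow G (A ?k) m"
    using small k by (intro pos_in_set_pow) auto
  have suf: "pos (\<lambda>j. \<omega> (Suc m + j)) (i - Suc m) \<in> set_pow G (A ?k) (i - Suc m)" (is "?q'' \<in> _")
    using small k by (intro pos_in_set_pow) auto
  have q: "pos \<omega> m \<in> set_pow G (A ?k) ?k" "pos \<omega> m \<in> set_pow G (A ?k) (?k + 1)"
    "?q'' \<in> set_pow G (A ?k) ?k"
    using pre suf k set_pow_mono[OF subset_refl one_in_A A_closed] by (meson less_imp_le le_trans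
        diff_le_self le_add1 subsetD)+
  have "pos \<omega> i = pos \<omega> (Suc m) \<otimes> ?q''"
    using pos_add[of \<omega> "Suc m" "i - Suc m"] \<omega> k by simp
  also have "\<dots> = pos \<omega> m \<otimes> b ?k \<otimes> inv f \<otimes> ?q''"
    using f b_closed[OF k(1)] F_closed[OF k(1)] pos_closed[of \<omega>] \<omega> by (simp add: m_assoc)
  finally have eq: "pos \<omega> i = pos \<omega> m \<otimes> b ?k \<otimes> inv f \<otimes> ?q''" .
  show "pos \<omega> i \<in> W' ?k"
    unfolding W'_iff using eq q f(1) by blast
  show "p (pos \<omega> i) = pos \<omega> m"
    unfolding eq using p_word[OF k(1) q(2,3) f(1)] .
qed

lemma t_peak:
  assumes "\<And>j. \<omega> j \<in> carrier G" "peak \<omega> i m"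
  shows "t (pos \<omega> i) = t (pos \<omega> m) @ [pos \<omega> m]"
proof -
  have "1 \<le> level (\<omega> m)"
    using assms(2) by (auto simp: peak_def is_blue_def)
  then show ?thesis
    using t_W_pos[of "level (\<omega> m)" "pos \<omega> i"] peak_position[OF assms] W'_subset_W_pos by auto
qed

text \<open>When one more increment is observed, the dominating one either stays the same, and \<open>t\<close> does not
  change, or is the new one, and the current position is appended to \<open>t\<close>.\<close>

lemma peak_next:
  assumes "peak \<omega> i m" "peak \<omega> (Suc i) m'"
  shows "m' = m \<or> m' = i"
  using assms unfolding peak_def by (metis less_Suc_eq less_asym)

text \<open>A fixed increment of level \<open>k\<close> dominates only up to time \<open>k\<close>, so new peaks keep appearing and the
  length of \<open>t\<close> is unbounded.\<close>

lemma peaks_imp_good: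
  assumes \<omega>: "\<And>j. \<omega> j \<in> carrier G" and peaks: "\<And>i. N < i \<Longrightarrow> \<exists>m. peak \<omega> i m"
  shows "good_from (\<lambda>i\<in>{1..}. pos \<omega> i) N"
proof -
  have step: "t (pos \<omega> (Suc i)) = t (pos \<omega> i) \<or> t (pos \<omega> (Suc i)) = t (pos \<omega> i) @ [pos \<omega> i]"
    if "N < i" for i
  proof -
    obtain m m' where m: "peak \<omega> i m" "peak \<omega> (Suc i) m'"
      using peaks[of i] peaks[of "Suc i"] \<open>N < i\<close> by auto
    from peak_next[OF this] show ?thesis
      using t_peak[of \<omega>, OF \<omega> m(1)] t_peak[of \<omega>, OF \<omega> m(2)] by auto
  qed
  have mono: "length (t (pos \<omega> i)) \<le> length (t (pos \<omega> (i + d)))" if "N < i" for i d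
  proof (induction d)
    case (Suc d)
    then show ?case
      using step[of "i + d"] \<open>N < i\<close> by auto
  qed simp
  have grow: "\<exists>i>N. L \<le> length (t (pos \<omega> i))" for L
  proof (induction L)
    case 0
    then show ?case by auto
  next
    case (Suc L)
    then obtain i where i: "N < i" "L \<le> length (t (pos \<omega> i))"
      by blast
    have "\<exists>d. peak \<omega> (Suc (i + d)) (i + d)"
    proof (rule ccontr)
      assume none: "\<nexists>d. peak \<omega> (Suc (i + d)) (i + d)"
      obtain m where m: "peak \<omega> i m"
        using peaks i by blast
      have "peak \<omega> (i + d) m" for d
      proof (induction d)
        case (Suc d)
        then show ?case
          using peaks[of "Suc (i + d)"] i(1) none peak_next[of \<omega> "i + d" m] by auto
      qed (simp add: m)
      from this[of "Suc (level (\<omega> m))"] show False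
        by (simp add: peak_def)
    qed
    then obtain d where d: "peak \<omega> (Suc (i + d)) (i + d)"
      by blast
    have "Suc L \<le> length (t (pos \<omega> (Suc (i + d))))"
      using t_peak[of \<omega>, OF \<omega> d] mono[OF i(1), of d] i(2) by simp
    then show ?case
      using i(1) by (intro exI[of _ "Suc (i + d)"]) simp
  qed
  have "\<exists>i>N. L \<le> length (t ((\<lambda>i\<in>{1..}. pos \<omega> i) i))" for L
  proof -
    obtain i where "N < i" "L \<le> length (t (pos \<omega> i))"
      using grow by blast
    then show ?thesis by (intro exI[of _ i]) simp
  qed
  moreover have "\<exists>k\<ge>1. pos \<omega> i \<in> W' k" if "N < i" for i
  proof -
    obtain m where m: "peak \<omega> i m"
      using peaks[OF \<open>N < i\<close>] by blast
    then show ?thesis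
      using peak_position(1)[of \<omega>, OF \<omega> m]
      by (intro exI[of _ "level (\<omega> m)"]) (simp add: peak_def is_blue_def)
  qed
  ultimately show ?thesis
    using step unfolding good_from_def by simp
qed

section \<open>The boundary map and the tail\<close>

lemma countable_carrier: "countable (carrier G)"
  using c_enum by (metis countable_image countableI_type)

lemma space_mu: "space mu = space path_algebra"
  by (simp add: mu_def)

lemma sets_mu: "sets mu = sets path_algebra"
  by (simp add: mu_def)

lemma in_space_path: "z \<in> space path_algebra \<longleftrightarrow> z \<in> extensional {1..} \<and> (\<forall>i\<ge>1. z i \<in> carrier G)"
  by (auto simp: path_algebra_def space_PiM PiE_def Pi_def)

lemma good_prefix:
  assumes "good_from z N" "N < i" "i \<le> j"
  shows "take (length (t (z i))) (t (z j)) = t (z i) \<and> length (t (z i)) \<le> length (t (z j))"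
  using assms(3)
proof (induction j rule: dec_induct)
  case (step j)
  then have "t (z (Suc j)) = t (z j) \<or> t (z (Suc j)) = t (z j) @ [z j]"
    using assms(1,2) by (simp add: good_from_def)
  then show ?case
    using step.IH by auto
qed simp

lemma good_nth:
  assumes "good_from z N" "N < i" "N < j" "k < length (t (z i))" "k < length (t (z j))"
  shows "t (z i) ! k = t (z j) ! k"
  using good_prefix[OF assms(1,2), of j] good_prefix[OF assms(1,3), of i] assms(4,5)
  by (metis nat_le_linear nth_take)

lemma good_long:
  assumes "good_from z N" "N \<le> M"
  shows "\<exists>i>M. L \<le> length (t (z i))"
proof -
  obtain i where i: "N < i" "L \<le> length (t (z i))"
    using assms(1) unfolding good_from_def by blast
  then have "L \<le> length (t (z (max i (Suc M))))"
    using good_prefix[OF assms(1) i(1), of "max i (Suc M)"] by simp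
  then show ?thesis
    by (intro exI[of _ "max i (Suc M)"]) simp
qed

lemma good_from_mono:
  assumes "good_from z N" "N \<le> M"
  shows "good_from z M"
  using assms good_long[OF assms] unfolding good_from_def by auto

lemma initial_segments_unique:
  assumes "good_from z N" "s \<in> space path_algebra" "\<forall>i>N. initial_segment (t (z i)) s"
    and "good_from z N'" "s' \<in> space path_algebra" "\<forall>i>N'. initial_segment (t (z i)) s'"
  shows "s = s'"
proof (rule extensionalityI[of _ "{1..}"])
  fix k :: nat assume "k \<in> {1..}"
  then have k: "1 \<le> k" by simp
  obtain i where i: "max N N' < i" "k \<le> length (t (z i))"
    using good_long[OF good_from_mono[OF assms(1) max.cobounded1] order_refl] by blast
  have "k - 1 < length (t (z i))"
    using i k by linarith
  then have "t (z i) ! (k - 1) = s (k - 1 + 1)" "t (z i) ! (k - 1) = s' (k - 1 + 1)"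
    using assms(3,6) i unfolding initial_segment_def by (meson max_less_iff_conj)+
  then show "s k = s' k"
    using k by simp
qed (use assms in \<open>simp_all add: in_space_path\<close>)

text \<open>The entries on which the lists \<open>t (z i)\<close> agree are glued to a sequence; the length of these lists is
  unbounded, so no other sequence extends all of them.\<close>

lemma tau_good:
  assumes z: "z \<in> space path_algebra" and good: "good_from z N"
  shows "tau z \<in> space path_algebra" "N < i \<Longrightarrow> initial_segment (t (z i)) (tau z)"
proof -
  define idx where "idx k = (SOME i. N < i \<and> k \<le> length (t (z i)))" for k
  have idx: "N < idx k" "k \<le> length (t (z (idx k)))" for k
    using someI_ex[OF good_long[OF good order_refl, of k]] unfolding idx_def by auto
  define s where "s = (\<lambda>k\<in>{1..}. t (z (idx k)) ! (k - 1))"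
  have "s k \<in> carrier G" if "1 \<le> k" for k
  proof -
    have "t (z (idx k)) ! (k - 1) \<in> set (t (z (idx k)))"
      using idx(2)[of k] that by (intro nth_mem) auto
    moreover have "z (idx k) \<in> carrier G"
      using z idx(1)[of k] by (simp add: in_space_path)
    ultimately show ?thesis
      using t_closed that unfolding s_def by auto
  qed
  then have s: "s \<in> space path_algebra"
    by (simp add: in_space_path s_def)
  have seg: "initial_segment (t (z i)) s" if "N < i" for i
    unfolding initial_segment_def
  proof (intro allI impI)
    fix k assume "k < length (t (z i))"
    then show "t (z i) ! k = s (k + 1)"
      using good_nth[OF good \<open>N < i\<close> idx(1)[of "Suc k"], of k] idx(2)[of "Suc k"]
      by (simp add: s_def)
  qed
  have "tau z = (THE s. s \<in> space path_algebra \<and>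
              (\<exists>N. good_from z N \<and> (\<forall>i>N. initial_segment (t (z i)) s)))"
    using good unfolding tau_def by auto
  also have "\<dots> = s"
    using s seg good initial_segments_unique by (intro the_equality) blast+
  finally have "tau z = s" .
  with s seg show "tau z \<in> space path_algebra" "N < i \<Longrightarrow> initial_segment (t (z i)) (tau z)"
    by simp_all
qed

lemma tau_entry:
  assumes "z \<in> space path_algebra" "good_from z N" "N < i" "1 \<le> k" "k \<le> length (t (z i))"
  shows "tau z k = t (z i) ! (k - 1)"
proof -
  have "k - 1 < length (t (z i))"
    using assms(4,5) by linarith
  then have "t (z i) ! (k - 1) = tau z (k - 1 + 1)"
    using tau_good(2)[OF assms(1-3)] unfolding initial_segment_def by blast
  then show ?thesis
    using assms(4) by simp
qed

text \<open>A new entry of \<open>t\<close> is the current position, so the entries of \<open>\<tau>\<close> past the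
  \<open>length (t (z i\<^sub>0))\<close>-th one are positions that the walk visits no earlier than \<open>i\<^sub>0\<close>.\<close>

lemma tau_entries_are_positions:
  assumes z: "z \<in> space path_algebra" and good: "good_from z N" and "N < i\<^sub>0"
  shows "\<exists>k\<^sub>0. \<forall>k\<ge>k\<^sub>0. \<exists>i\<ge>i\<^sub>0. tau z k = z i"
proof (rule exI[of _ "Suc (length (t (z i\<^sub>0)))"], intro allI impI)
  fix k assume k: "Suc (length (t (z i\<^sub>0))) \<le> k"
  \<comment> \<open>The \<open>k\<close>-th entry is appended at the step from \<open>j - 1\<close> to \<open>j\<close>.\<close>
  define j where "j = (LEAST j. i\<^sub>0 \<le> j \<and> k \<le> length (t (z j)))"
  obtain j' where "i\<^sub>0 < j' \<and> k \<le> length (t (z j'))"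
    using good_long[OF good, of i\<^sub>0] \<open>N < i\<^sub>0\<close> by auto
  then have "i\<^sub>0 \<le> j' \<and> k \<le> length (t (z j'))"
    by simp
  then have j: "i\<^sub>0 \<le> j \<and> k \<le> length (t (z j))"
    unfolding j_def by (rule LeastI)
  moreover have "j \<noteq> i\<^sub>0"
    using j k by auto
  ultimately obtain i where i: "j = Suc i" "i\<^sub>0 \<le> i"
    by (cases j) auto
  have short: "length (t (z i)) < k"
    using not_less_Least[of i "\<lambda>j. i\<^sub>0 \<le> j \<and> k \<le> length (t (z j))"] i unfolding j_def by auto
  have "t (z j) = t (z i) \<or> t (z j) = t (z i) @ [z i]"
    using good i \<open>N < i\<^sub>0\<close> by (simp add: good_from_def)
  with short j have "t (z j) = t (z i) @ [z i]" "k = Suc (length (t (z i)))"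
    by auto
  then have "tau z k = z i"
    using tau_entry[OF z good, of j k] j \<open>N < i\<^sub>0\<close> by simp
  with i show "\<exists>i\<ge>i\<^sub>0. tau z k = z i" by blast
qed

lemma tau_closed: "z \<in> space path_algebra \<Longrightarrow> tau z \<in> space path_algebra"
proof (cases "\<exists>N. good_from z N")
  case False
  then have "tau z = (\<lambda>i\<in>{1..}. \<one>)"
    by (simp add: tau_def)
  then show ?thesis
    by (simp add: in_space_path)
qed (use tau_good(1) in blast)

text \<open>The tail is the intersection of these \<open>\<sigma>\<close>-algebras (\<open>tail_algebra_eq\<close>); as measurable spaces they
  allow the measurability of \<open>\<tau>\<close> to be checked coordinatewise.\<close>

definition future :: "nat \<Rightarrow> (nat \<Rightarrow> 'a) measure" where
  "future n = sigma (space mu)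
     (\<Union>i\<in>{n..}. sets (vimage_algebra (space mu) (\<lambda>z. z (Suc i)) (count_space (carrier G))))"

lemma space_future: "space (future n) = space path_algebra"
  unfolding future_def space_mu[symmetric] by (simp add: space_measure_of_conv)

lemma future_generators:
  "(\<Union>i\<in>{n..}. sets (vimage_algebra (space mu) (\<lambda>z. z (Suc i)) (count_space (carrier G))))
     \<subseteq> Pow (space mu)"
  using sets.space_closed[of "vimage_algebra (space mu) (\<lambda>z. z (Suc i)) (count_space (carrier G))" for i]
  by fastforce

lemma sets_future:
  "sets (future n) = sigma_sets (space mu)
     (\<Union>i\<in>{n..}. sets (vimage_algebra (space mu) (\<lambda>z. z (Suc i)) (count_space (carrier G))))"
  unfolding future_def using future_generators by (rule sets_measure_of)

lemma tail_algebra_eq: "tail_algebra = (\<Inter>n. sets (future n))"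
  unfolding tail_algebra_def prob_space.tail_events_def[OF prob_space_mu] sets_future ..

lemma measurable_coordinate_future:
  assumes "n < i"
  shows "(\<lambda>z. z i) \<in> future n \<rightarrow>\<^sub>M count_space (carrier G)"
proof (rule measurableI)
  fix z assume "z \<in> space (future n)"
  then show "z i \<in> space (count_space (carrier G))"
    using assms by (simp add: space_future in_space_path)
next
  fix X assume X: "X \<in> sets (count_space (carrier G))"
  have "(\<lambda>z. z (Suc (i - 1))) -` X \<inter> space mu
      \<in> sets (vimage_algebra (space mu) (\<lambda>z. z (Suc (i - 1))) (count_space (carrier G)))"
    using X by (rule in_vimage_algebra)
  then show "(\<lambda>z. z i) -` X \<inter> space (future n) \<in> sets (future n)"
    unfolding sets_future space_future space_mu[symmetric] using assms
    by (intro sigma_sets.Basic UN_I[of "i - 1"]) auto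
qed

lemma pred_future:
  assumes "n < i"
  shows "Measurable.pred (future n) (\<lambda>z. P (z i))"
  using measurable_compose[OF measurable_coordinate_future[OF assms], of P] by simp

lemma pred_future2:
  assumes "n < i" "n < j"
  shows "Measurable.pred (future n) (\<lambda>z. P (z i) (z j))"
  by (rule measurable_compose_countable'[OF _ measurable_coordinate_future[OF assms(1)] countable_carrier])
    (rule pred_future[OF assms(2)])

lemma pred_good_from:
  assumes "n \<le> N"
  shows "Measurable.pred (future n) (\<lambda>z. good_from z N)"
proof -
  define visits appends reaches
    where "visits i z \<longleftrightarrow> (\<exists>j\<ge>1. z i \<in> W' j)"
      and "appends i z \<longleftrightarrow> t (z (i + 1)) = t (z i) \<or> t (z (i + 1)) = t (z i) @ [z i]"
      and "reaches i L z \<longleftrightarrow> L \<le> length (t (z i))"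
    for i L :: nat and z :: "nat \<Rightarrow> 'a"
  have [measurable]: "Measurable.pred (future n) (visits (Suc (N + i)))"
    "Measurable.pred (future n) (appends (Suc (N + i)))"
    "Measurable.pred (future n) (reaches (Suc (N + i)) L)" for i L
    unfolding visits_def appends_def reaches_def
    using assms
    by (intro pred_future pred_future2[where P = "\<lambda>g' g. t g' = t g \<or> t g' = t g @ [g]"]; simp)+
  have shift: "(\<forall>i>N. P i) \<longleftrightarrow> (\<forall>i. P (Suc (N + i)))" "(\<exists>i>N. P i) \<longleftrightarrow> (\<exists>i. P (Suc (N + i)))" for P
    using less_iff_Suc_add[of N] by auto
  have "good_from z N \<longleftrightarrow> (\<forall>i. visits (Suc (N + i)) z) \<and> (\<forall>i. appends (Suc (N + i)) z) \<and>
      (\<forall>L. \<exists>i. reaches (Suc (N + i)) L z)" for z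
    unfolding good_from_def shift visits_def appends_def reaches_def ..
  then show ?thesis
    by (simp only:) measurable
qed

text \<open>Goodness from some time on may be tested at times after \<open>n\<close> only, and every entry of \<open>\<tau>\<close> appears
  in \<open>t (z i)\<close> for arbitrarily late \<open>i\<close>.\<close>

lemma measurable_tau_future: "tau \<in> future n \<rightarrow>\<^sub>M path_algebra"
proof -
  have coord: "(\<lambda>z. tau z k) \<in> future n \<rightarrow>\<^sub>M count_space (carrier G)" if k: "1 \<le> k" for k
  proof -
    have "{z \<in> space (future n). tau z k = g} \<in> sets (future n)" for g
    proof -
      define good entry where "good N z \<longleftrightarrow> good_from z (n + N)"
        and "entry i z \<longleftrightarrow> k \<le> length (t (z i)) \<and> t (z i) ! (k - 1) = g" for N i z
      have [measurable]: "Measurable.pred (future n) (good N)"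
        "Measurable.pred (future n) (entry (Suc (n + i)))" for N i
        unfolding good_def entry_def by (intro pred_good_from pred_future; simp)+
      have "tau z k = g \<longleftrightarrow>
         (if \<exists>N. good N z then \<exists>N i. good N z \<and> entry (Suc (n + (N + i))) z else g = \<one>)"
        if z: "z \<in> space (future n)" for z
      proof (cases "\<exists>N. good_from z N")
        case True
        then obtain N where "good_from z N" by blast
        then have N: "good N z"
          unfolding good_def by (rule good_from_mono) simp
        obtain j where j: "n + N < j" "k \<le> length (t (z j))"
          using good_long[of z "n + N"] N unfolding good_def by blast
        have tau: "entry (Suc (n + (M + i))) z \<longleftrightarrow>
            k \<le> length (t (z (Suc (n + (M + i))))) \<and> tau z k = g" if "good M z" for M i
          using tau_entry[of z "n + M" "Suc (n + (M + i))" k] that k z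
          unfolding entry_def good_def by (auto simp: space_future)
        obtain i where "j = Suc (n + (N + i))"
          using j(1) by (metis less_iff_Suc_add add.assoc)
        with j(2) tau N show ?thesis by auto
      next
        case False
        then have "tau z k = \<one>"
          using k by (simp add: tau_def)
        with False show ?thesis
          by (auto simp: good_def)
      qed
      then have "{z \<in> space (future n). tau z k = g} = {z \<in> space (future n).
         if \<exists>N. good N z then \<exists>N i. good N z \<and> entry (Suc (n + (N + i))) z else g = \<one>}"
        by blast
      also have "\<dots> \<in> sets (future n)"
        by measurable
      finally show ?thesis .
    qed
    then have "(\<lambda>z. tau z k) -` {g} \<inter> space (future n) \<in> sets (future n)" for g
      by (simp add: vimage_def Int_def conj_commute)
    then show ?thesis
      using tau_closed k unfolding measurable_count_space_eq_countable[OF countable_carrier]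
      by (auto simp: space_future in_space_path)
  qed
  have "(\<lambda>z k. tau z k) \<in> future n \<rightarrow>\<^sub>M path_algebra"
    unfolding path_algebra_def
    by (rule measurable_PiM_single')
      (use coord tau_closed in \<open>auto simp: space_future path_algebra_def space_PiM\<close>)
  then show ?thesis by simp
qed

lemma sets_future_subset: "sets (future n) \<subseteq> sets mu"
proof -
  have "(\<lambda>z. z i) \<in> mu \<rightarrow>\<^sub>M count_space (carrier G)" if "1 \<le> i" for i
    using that measurable_cong_sets[OF sets_mu refl] unfolding path_algebra_def
    by (auto intro!: measurable_component_singleton)
  then have "sets (vimage_algebra (space mu) (\<lambda>z. z (Suc i)) (count_space (carrier G))) \<subseteq> sets mu" for i
    by (intro sets_image_in_sets) auto
  then show ?thesis
    unfolding sets_future by (intro sets.sigma_sets_subset) auto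
qed

lemma measurable_tau: "tau \<in> mu \<rightarrow>\<^sub>M path_algebra"
  using measurable_tau_future[of 0] sets_future_subset[of 0]
  by (auto simp: measurable_def space_future space_mu)

lemma tau_algebra_eq: "tau_algebra = {tau -` B \<inter> space mu | B. B \<in> sets path_algebra}"
  unfolding tau_algebra_def by (rule sets_vimage_algebra2) (simp add: tau_closed space_mu)

lemma tau_algebra_subset_tail: "tau_algebra \<subseteq> tail_algebra"
  unfolding tau_algebra_eq tail_algebra_eq
  using measurable_sets[OF measurable_tau_future] by (auto simp: space_future space_mu)

text \<open>An event of the future after time \<open>n\<close> does not see the first \<open>n\<close> positions.\<close>

lemma future_event_cong:
  assumes "T \<in> sets (future n)" "z \<in> space path_algebra" "z' \<in> space path_algebra"
    and "\<And>i. n < i \<Longrightarrow> z i = z' i"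
  shows "z \<in> T \<longleftrightarrow> z' \<in> T"
proof -
  let ?\<A> = "\<Union>i\<in>{n..}. sets (vimage_algebra (space mu) (\<lambda>z. z (Suc i)) (count_space (carrier G)))"
  have "T \<in> sigma_sets (space mu) ?\<A>"
    using assms(1) by (simp add: sets_future)
  then show ?thesis
  proof induction
    case (Basic a)
    then obtain i where i: "n \<le> i"
      "a \<in> sets (vimage_algebra (space mu) (\<lambda>z. z (Suc i)) (count_space (carrier G)))"
      by auto
    have "sets (vimage_algebra (space mu) (\<lambda>z. z (Suc i)) (count_space (carrier G))) =
       {(\<lambda>z. z (Suc i)) -` X \<inter> space mu | X. X \<in> sets (count_space (carrier G))}"
      by (rule sets_vimage_algebra2) (auto simp: space_mu in_space_path)
    with i obtain X where "a = (\<lambda>z. z (Suc i)) -` X \<inter> space mu"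
      by auto
    then show ?case
      using assms(2-4) i(1) by (simp add: space_mu)
  qed (use assms(2,3) in \<open>auto simp: space_mu\<close>)
qed

section \<open>The walk driven by an i.i.d. sequence indexed from zero\<close>

abbreviation steps :: "(nat \<Rightarrow> 'a) measure" where
  "steps \<equiv> \<Pi>\<^sub>M i\<in>UNIV. nu_measure"

definition path :: "(nat \<Rightarrow> 'a) \<Rightarrow> nat \<Rightarrow> 'a" where
  "path \<omega> = (\<lambda>i\<in>{1..}. pos \<omega> i)"

interpretation steps: sequence_space nu_measure
  unfolding sequence_space_def product_prob_space_def product_prob_space_axioms_def
    product_sigma_finite_def
  using prob_space_nu_measure prob_space_imp_sigma_finite by blast

lemma in_space_steps: "\<omega> \<in> space steps \<longleftrightarrow> (\<forall>j. \<omega> j \<in> carrier G)"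
  by (auto simp: space_PiM space_nu_measure PiE_def Pi_def)

lemma measurable_step: "(\<lambda>\<omega>. \<omega> j) \<in> steps \<rightarrow>\<^sub>M count_space (carrier G)"
  using measurable_cong_sets[OF refl sets_nu_measure, of steps]
  by (auto intro!: measurable_component_singleton)

lemma measurable_pos: "(\<lambda>\<omega>. pos \<omega> n) \<in> steps \<rightarrow>\<^sub>M count_space (carrier G)"
proof (induction n)
  case (Suc n)
  have "(\<lambda>\<omega>. g \<otimes> \<omega> n) \<in> steps \<rightarrow>\<^sub>M count_space (carrier G)" if "g \<in> carrier G" for g
    using measurable_compose[OF measurable_step, of "\<lambda>h. g \<otimes> h" "count_space (carrier G)"] that
    by auto
  from measurable_compose_countable'[OF this Suc.IH countable_carrier] show ?case
    by simp
qed simp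

lemma measurable_path: "path \<in> steps \<rightarrow>\<^sub>M path_algebra"
  unfolding path_def path_algebra_def
  by (rule measurable_restrict) (rule measurable_pos)

lemma path_in_space: "\<omega> \<in> space steps \<Longrightarrow> path \<omega> \<in> space path_algebra"
  using measurable_space[OF measurable_path] by blast

lemma mu_eq: "mu = distr steps path_algebra path"
proof -
  have reindex: "distr steps increments (\<lambda>\<omega>. \<lambda>n\<in>{1..}. \<omega> (n - 1)) = increments"
    unfolding increments_def
    by (rule distr_PiM_reindex[where f = "\<lambda>n. n - 1"])
      (auto simp: prob_space_nu_measure inj_on_def)
  have "(\<lambda>\<omega>. \<lambda>n\<in>{1..}. \<omega> (n - 1)) \<in> steps \<rightarrow>\<^sub>M increments"
    unfolding increments_def by (rule measurable_restrict) simp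
  from distr_distr[OF walk_measurable this] have "distr steps path_algebra
        ((\<lambda>x. \<lambda>i\<in>{1..}. walk x i) \<circ> (\<lambda>\<omega>. \<lambda>n\<in>{1..}. \<omega> (n - 1))) = mu"
    unfolding reindex mu_def by (rule sym)
  moreover have "walk (\<lambda>n\<in>{1..}. \<omega> (n - 1)) i = pos \<omega> i" for \<omega> i
    by (induction i) auto
  then have "(\<lambda>x. \<lambda>i\<in>{1..}. walk x i) \<circ> (\<lambda>\<omega>. \<lambda>n\<in>{1..}. \<omega> (n - 1)) = path"
    by (auto simp: path_def fun_eq_iff)
  ultimately show ?thesis by simp
qed

lemma comb_seq_in_space:
  "\<omega> \<in> space steps \<Longrightarrow> \<omega>' \<in> space steps \<Longrightarrow> comb_seq n \<omega> \<omega>' \<in> space steps"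
  by (auto simp: in_space_steps comb_seq_def)

lemma pos_cong: "(\<And>j. j < n \<Longrightarrow> \<omega> j = \<omega>' j) \<Longrightarrow> pos \<omega> n = pos \<omega>' n"
  by (induction n) auto

lemma pos_comb_seq:
  assumes "\<omega> \<in> space steps" "\<omega>' \<in> space steps"
  shows "pos (comb_seq n \<omega> \<omega>') (n + m) = pos \<omega> n \<otimes> pos \<omega>' m"
proof -
  have "pos (comb_seq n \<omega> \<omega>') n = pos \<omega> n"
    by (rule pos_cong) (simp add: comb_seq_def)
  moreover have "(\<lambda>j. comb_seq n \<omega> \<omega>' (n + j)) = \<omega>'"
    by (simp add: comb_seq_def)
  ultimately show ?thesis
    using pos_add[of "comb_seq n \<omega> \<omega>'" n m] comb_seq_in_space[OF assms]
    by (simp add: in_space_steps)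
qed

text \<open>Independence of the first \<open>n\<close> increments from the remaining ones, as a Fubini formula.\<close>

lemma emeasure_steps_split:
  assumes "Q \<in> sets steps"
  shows "emeasure steps Q =
    (\<integral>\<^sup>+\<omega>. emeasure steps {\<omega>' \<in> space steps. comb_seq n \<omega> \<omega>' \<in> Q} \<partial>steps)"
proof -
  let ?f = "\<lambda>(\<omega>, \<omega>'). comb_seq n \<omega> \<omega>'"
  have meas: "?f \<in> steps \<Otimes>\<^sub>M steps \<rightarrow>\<^sub>M steps"
    by (rule measurable_comb_seq)
  have "emeasure steps Q = emeasure (distr (steps \<Otimes>\<^sub>M steps) steps ?f) Q"
    by (simp only: steps.PiM_comb_seq)
  also have "\<dots> = emeasure (steps \<Otimes>\<^sub>M steps) (?f -` Q \<inter> space (steps \<Otimes>\<^sub>M steps))"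
    using meas assms by (rule emeasure_distr)
  also have "\<dots> = (\<integral>\<^sup>+\<omega>. emeasure steps (Pair \<omega> -` (?f -` Q \<inter> space (steps \<Otimes>\<^sub>M steps))) \<partial>steps)"
    using measurable_sets[OF meas assms] by (rule steps.P.emeasure_pair_measure_alt)
  also have "\<dots> = (\<integral>\<^sup>+\<omega>. emeasure steps {\<omega>' \<in> space steps. comb_seq n \<omega> \<omega>' \<in> Q} \<partial>steps)"
    by (intro nn_integral_cong arg_cong[where f = "emeasure steps"])
      (auto simp: space_pair_measure)
  finally show ?thesis .
qed

section \<open>Events determined by finitely many increments\<close>

definition determined_before :: "nat \<Rightarrow> (nat \<Rightarrow> 'a) set \<Rightarrow> bool" where
  "determined_before n C \<longleftrightarrow> (\<forall>\<omega>\<in>space steps. \<forall>\<omega>'\<in>space steps.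
     (\<forall>j<n. \<omega> j = \<omega>' j) \<longrightarrow> \<omega> \<in> C \<longrightarrow> \<omega>' \<in> C)"

lemma determined_before_iff:
  assumes "determined_before n C" "\<omega> \<in> space steps" "\<omega>' \<in> space steps" "\<And>j. j < n \<Longrightarrow> \<omega> j = \<omega>' j"
  shows "\<omega> \<in> C \<longleftrightarrow> \<omega>' \<in> C"
  using assms unfolding determined_before_def by metis

lemma determined_before_mono: "determined_before m C \<Longrightarrow> m \<le> n \<Longrightarrow> determined_before n C"
  unfolding determined_before_def by (meson order_less_le_trans)

text \<open>The approximable events contain the one-coordinate events and are closed under complements and
  countable unions; in a union of \<open>A i\<close> all but finitely many sets are discarded at a cost of \<open>\<epsilon> / 2\<close>.\<close>

lemma approximation_by_finitely_determined:
  assumes "E \<in> sets steps" "0 < \<epsilon>"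
  shows "\<exists>n C. C \<in> sets steps \<and> determined_before n C \<and> measure steps (sym_diff E C) < \<epsilon>"
proof -
  let ?\<G> = "{{f \<in> \<Pi>\<^sub>E i\<in>UNIV. space nu_measure. f i \<in> X} | i X. i \<in> (UNIV :: nat set) \<and> X \<in> sets nu_measure}"
  have sets: "sets steps = sigma_sets (\<Pi>\<^sub>E i\<in>UNIV. space nu_measure) ?\<G>"
    by (rule sets_PiM_single)
  have "E \<in> sigma_sets (\<Pi>\<^sub>E i\<in>UNIV. space nu_measure) ?\<G>"
    using assms(1) by (simp only: sets)
  then show ?thesis
    using assms(2)
  proof (induction arbitrary: \<epsilon>)
    case (Basic a)
    then have "a \<in> sets steps"
      unfolding sets by (intro sigma_sets.Basic)
    moreover obtain i X where "a = {f \<in> \<Pi>\<^sub>E i\<in>UNIV. space nu_measure. f i \<in> X}"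
      using Basic by blast
    then have "determined_before (Suc i) a"
      unfolding determined_before_def space_PiM by auto
    ultimately show ?case
      using Basic.prems by (intro exI[of _ "Suc i"] exI[of _ a]) simp
  next
    case Empty
    then show ?case
      by (intro exI[of _ 0] exI[of _ "{}"]) (simp add: determined_before_def)
  next
    case (Compl a)
    have a: "a \<subseteq> space steps"
      using Compl.hyps sets.sets_into_space[of a steps] by (simp add: sets)
    obtain n C where C: "C \<in> sets steps" "determined_before n C" "measure steps (sym_diff a C) < \<epsilon>"
      using Compl by blast
    have "sym_diff (space steps - a) (space steps - C) = sym_diff a C"
      using a sets.sets_into_space[OF C(1)] by blast
    moreover have "determined_before n (space steps - C)"
      unfolding determined_before_def using determined_before_iff[OF C(2)] by blast
    ultimately show ?case
      using C sets.compl_sets[OF C(1)]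
      by (intro exI[of _ n] exI[of _ "space steps - C"]) (simp add: space_PiM)
  next
    case (Union A)
    have A: "A i \<in> sets steps" for i
      using Union.hyps by (simp only: sets)
    have "(\<lambda>n. measure steps (\<Union>i<n. A i)) \<longlonglongrightarrow> measure steps (\<Union>n. \<Union>i<n. A i)"
      using A by (intro steps.P.finite_Lim_measure_incseq) (auto simp: incseq_def, meson lessThan_iff less_le_trans)
    moreover have "(\<Union>n. \<Union>i<n. A i) = (\<Union>i. A i)"
      by auto
    ultimately have "(\<lambda>n. measure steps (\<Union>i<n. A i)) \<longlonglongrightarrow> measure steps (\<Union>i. A i)"
      by simp
    then have "\<forall>\<^sub>F n in sequentially. measure steps (\<Union>i. A i) - \<epsilon> / 2 < measure steps (\<Union>i<n. A i)"
      using Union.prems by (intro order_tendstoD(1)) auto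
    then obtain n where n: "measure steps (\<Union>i. A i) - \<epsilon> / 2 < measure steps (\<Union>i<n. A i)"
      using eventually_happens'[OF sequentially_bot] by blast
    have rest: "measure steps ((\<Union>i. A i) - (\<Union>i<n. A i)) < \<epsilon> / 2"
      using n A by (subst steps.P.finite_measure_Diff) auto
    have "\<exists>m C. C \<in> sets steps \<and> determined_before m C \<and>
        measure steps (sym_diff (A i) C) < \<epsilon> / (2 * (real n + 1))" for i
      using Union.IH[of "\<epsilon> / (2 * (real n + 1))" i] Union.prems by simp
    then obtain m C where C: "\<And>i. C i \<in> sets steps" "\<And>i. determined_before (m i) (C i)"
      "\<And>i. measure steps (sym_diff (A i) (C i)) < \<epsilon> / (2 * (real n + 1))"
      by metis
    define N where "N = (\<Sum>i<n. m i)"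
    have "determined_before N (C i)" if "i < n" for i
      using C(2)[of i] unfolding N_def
      by (rule determined_before_mono) (use that in \<open>auto intro!: member_le_sum\<close>)
    then have det: "determined_before N (\<Union>i<n. C i)"
      unfolding determined_before_def by blast
    have "measure steps (sym_diff (\<Union>i. A i) (\<Union>i<n. C i)) \<le>
        measure steps (((\<Union>i. A i) - (\<Union>i<n. A i)) \<union> (\<Union>i<n. sym_diff (A i) (C i)))"
      using A C(1) by (intro steps.P.finite_measure_mono) auto
    also have "\<dots> \<le> measure steps ((\<Union>i. A i) - (\<Union>i<n. A i)) + measure steps (\<Union>i<n. sym_diff (A i) (C i))"
      using A C(1) by (intro measure_Un_le) auto
    also have "measure steps (\<Union>i<n. sym_diff (A i) (C i)) \<le> (\<Sum>i<n. measure steps (sym_diff (A i) (C i)))"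
      using A C(1) by (intro measure_UNION_le) auto
    also have "\<dots> \<le> (\<Sum>i<n. \<epsilon> / (2 * (real n + 1)))"
      using C(3) by (intro sum_mono less_imp_le)
    also have "\<dots> \<le> \<epsilon> / 2"
      using Union.prems by (simp add: field_simps)
    finally have "measure steps (sym_diff (\<Union>i. A i) (\<Union>i<n. C i)) < \<epsilon>"
      using rest by simp
    with det C(1) show ?case
      by (intro exI[of _ N] exI[of _ "\<Union>i<n. C i"]) auto
  qed
qed

section \<open>The harmonic function of a tail event\<close>

text \<open>The walk that is at \<open>g\<close> at time \<open>n\<close> and continues with the increments \<open>\<omega>\<close>. Its values before time \<open>n\<close>
  (constantly \<open>g\<close>, by truncated subtraction) are invisible to tail events.\<close>

definition path_from :: "nat \<Rightarrow> 'a \<Rightarrow> (nat \<Rightarrow> 'a) \<Rightarrow> nat \<Rightarrow> 'a" where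
  "path_from n g \<omega> = (\<lambda>i\<in>{1..}. g \<otimes> pos \<omega> (i - n))"

definition tail_prob :: "(nat \<Rightarrow> 'a) set \<Rightarrow> nat \<Rightarrow> 'a \<Rightarrow> real" where
  "tail_prob T n g = measure steps {\<omega> \<in> space steps. path_from n g \<omega> \<in> T}"

lemma tail_in_future: "T \<in> tail_algebra \<Longrightarrow> T \<in> sets (future n)"
  by (auto simp: tail_algebra_eq)

lemma tail_in_path_sets: "T \<in> tail_algebra \<Longrightarrow> T \<in> sets path_algebra"
  using tail_in_future[of T 0] sets_future_subset[of 0] by (auto simp: sets_mu)

lemma tail_Compl: "T \<in> tail_algebra \<Longrightarrow> space path_algebra - T \<in> tail_algebra"
  using sets.compl_sets[of T "future n" for n] by (auto simp: tail_algebra_eq space_future)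

lemma measurable_path_from:
  assumes "g \<in> carrier G"
  shows "path_from n g \<in> steps \<rightarrow>\<^sub>M path_algebra"
  unfolding path_from_def path_algebra_def
proof (rule measurable_restrict)
  show "(\<lambda>\<omega>. g \<otimes> pos \<omega> (i - n)) \<in> steps \<rightarrow>\<^sub>M count_space (carrier G)" for i
    using measurable_compose[OF measurable_pos, of "\<lambda>h. g \<otimes> h" "count_space (carrier G)"] assms
    by auto
qed

lemma path_from_event:
  assumes "T \<in> tail_algebra" "g \<in> carrier G"
  shows "{\<omega> \<in> space steps. path_from n g \<omega> \<in> T} \<in> sets steps"
proof -
  have "path_from n g -` T \<inter> space steps \<in> sets steps"
    by (rule measurable_sets[OF measurable_path_from[OF assms(2)] tail_in_path_sets[OF assms(1)]])
  moreover have "path_from n g -` T \<inter> space steps = {\<omega> \<in> space steps. path_from n g \<omega> \<in> T}"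
    by auto
  ultimately show ?thesis by simp
qed

lemma path_from_comb_seq:
  assumes T: "T \<in> tail_algebra" and g: "g \<in> carrier G"
    and \<omega>: "\<omega> \<in> space steps" "\<omega>' \<in> space steps"
  shows "path_from n g (comb_seq m \<omega> \<omega>') \<in> T \<longleftrightarrow> path_from (n + m) (g \<otimes> pos \<omega> m) \<omega>' \<in> T"
proof (rule future_event_cong[OF tail_in_future[OF T]])
  have pc: "pos \<omega> k \<in> carrier G" "pos \<omega>' k \<in> carrier G" for k
    using pos_closed \<omega> by (auto simp: in_space_steps)
  show "path_from n g (comb_seq m \<omega> \<omega>') \<in> space path_algebra"
    by (rule measurable_space[OF measurable_path_from[OF g] comb_seq_in_space[OF \<omega>]])
  show "path_from (n + m) (g \<otimes> pos \<omega> m) \<omega>' \<in> space path_algebra"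
    using g pc by (intro measurable_space[OF measurable_path_from \<omega>(2)]) simp
  fix i assume i: "n + m < i"
  have "pos (comb_seq m \<omega> \<omega>') (i - n) = pos \<omega> m \<otimes> pos \<omega>' (i - (n + m))"
    using pos_comb_seq[OF \<omega>, of m "i - (n + m)"] i by simp
  then show "path_from n g (comb_seq m \<omega> \<omega>') i = path_from (n + m) (g \<otimes> pos \<omega> m) \<omega>' i"
    using i g pc by (simp add: path_from_def m_assoc)
qed

lemma path_from_start: "\<omega> \<in> space steps \<Longrightarrow> path_from 0 \<one> \<omega> = path \<omega>"
  using pos_closed by (auto simp: path_from_def path_def in_space_steps fun_eq_iff)

lemma measurable_tail_prob_pos: "(\<lambda>\<omega>. tail_prob T n (g \<otimes> pos \<omega> m)) \<in> borel_measurable steps"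
  using measurable_compose[OF measurable_pos, of "\<lambda>h. tail_prob T n (g \<otimes> h)" borel] by simp

lemma tail_prob_bounds: "0 \<le> tail_prob T n g" "tail_prob T n g \<le> 1"
  by (auto simp: tail_prob_def)

text \<open>Given the first \<open>m\<close> increments, the rest of the path is a fresh walk started at the current
  position.\<close>

lemma markov_property:
  assumes T: "T \<in> tail_algebra" and g: "g \<in> carrier G"
    and Q: "Q \<in> sets steps" "determined_before m Q"
  shows "measure steps (Q \<inter> {\<omega> \<in> space steps. path_from n g \<omega> \<in> T}) =
    (\<integral>\<omega>. indicator Q \<omega> * tail_prob T (n + m) (g \<otimes> pos \<omega> m) \<partial>steps)" (is "measure _ ?E = _")
proof -
  have E: "?E \<in> sets steps"
    using Q(1) path_from_event[OF T g] by (rule sets.Int)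
  have "emeasure steps ?E =
      (\<integral>\<^sup>+\<omega>. emeasure steps {\<omega>' \<in> space steps. comb_seq m \<omega> \<omega>' \<in> ?E} \<partial>steps)"
    by (rule emeasure_steps_split[OF E])
  also have "\<dots> = (\<integral>\<^sup>+\<omega>. ennreal (indicator Q \<omega> * tail_prob T (n + m) (g \<otimes> pos \<omega> m)) \<partial>steps)"
  proof (rule nn_integral_cong)
    fix \<omega> assume \<omega>: "\<omega> \<in> space steps"
    have "comb_seq m \<omega> \<omega>' \<in> Q \<longleftrightarrow> \<omega> \<in> Q" if "\<omega>' \<in> space steps" for \<omega>'
      by (rule determined_before_iff[OF Q(2) comb_seq_in_space[OF \<omega> that] \<omega>]) (simp add: comb_seq_def)
    then have "comb_seq m \<omega> \<omega>' \<in> ?E \<longleftrightarrow> \<omega> \<in> Q \<and> path_from (n + m) (g \<otimes> pos \<omega> m) \<omega>' \<in> T"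
      if "\<omega>' \<in> space steps" for \<omega>'
      using comb_seq_in_space[OF \<omega> that] path_from_comb_seq[OF T g \<omega> that] that by simp
    then have "{\<omega>' \<in> space steps. comb_seq m \<omega> \<omega>' \<in> ?E} =
        (if \<omega> \<in> Q then {\<omega>' \<in> space steps. path_from (n + m) (g \<otimes> pos \<omega> m) \<omega>' \<in> T} else {})"
      by (cases "\<omega> \<in> Q") (simp_all cong: conj_cong)
    then show "emeasure steps {\<omega>' \<in> space steps. comb_seq m \<omega> \<omega>' \<in> ?E} =
        ennreal (indicator Q \<omega> * tail_prob T (n + m) (g \<otimes> pos \<omega> m))"
      by (simp add: tail_prob_def steps.P.emeasure_eq_measure)
  qed
  also have "\<dots> = ennreal (\<integral>\<omega>. indicator Q \<omega> * tail_prob T (n + m) (g \<otimes> pos \<omega> m) \<partial>steps)"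
  proof (rule nn_integral_eq_integral)
    show "integrable steps (\<lambda>\<omega>. indicator Q \<omega> * tail_prob T (n + m) (g \<otimes> pos \<omega> m))"
      using Q(1) measurable_tail_prob_pos tail_prob_bounds
      by (intro steps.P.integrable_const_bound[of _ 1]) (auto simp: indicator_def)
  qed (simp add: tail_prob_bounds)
  finally show ?thesis
    by (simp add: steps.P.emeasure_eq_measure tail_prob_bounds integral_nonneg_AE)
qed

lemma tail_prob_harmonic:
  assumes T: "T \<in> tail_algebra" and g: "g \<in> carrier G"
  shows "tail_prob T n g = (\<integral>\<omega>. tail_prob T (Suc n) (g \<otimes> \<omega> 0) \<partial>steps)"
proof -
  have "tail_prob T n g = measure steps (space steps \<inter> {\<omega> \<in> space steps. path_from n g \<omega> \<in> T})"
    unfolding tail_prob_def by (intro arg_cong[where f = "measure steps"]) auto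
  also have "\<dots> = (\<integral>\<omega>. indicator (space steps) \<omega> * tail_prob T (n + 1) (g \<otimes> pos \<omega> 1) \<partial>steps)"
    by (rule markov_property[OF T g]) (auto simp: determined_before_def)
  also have "\<dots> = (\<integral>\<omega>. tail_prob T (Suc n) (g \<otimes> \<omega> 0) \<partial>steps)"
    using g by (intro Bochner_Integration.integral_cong) (auto simp: in_space_steps)
  finally show ?thesis .
qed

lemma measure_step: "measure steps {\<omega> \<in> space steps. \<omega> j \<in> X} = measure (measure_pmf nu) X"
proof -
  have null: "measure (measure_pmf nu) X = measure (measure_pmf nu) (X \<inter> carrier G)"
    using set_pmf_nu by (intro measure_pmf.finite_measure_eq_AE) (auto simp: AE_measure_pmf_iff)
  have "{\<omega> \<in> space steps. \<omega> j \<in> X} = {\<omega> \<in> space steps. \<omega> j \<in> X \<inter> carrier G}"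
    by (auto simp: in_space_steps)
  then have "emeasure steps {\<omega> \<in> space steps. \<omega> j \<in> X} = emeasure nu_measure (X \<inter> carrier G)"
    using steps.emeasure_PiM_Collect_single[of j "X \<inter> carrier G"] by (simp add: sets_nu_measure)
  also have "\<dots> = emeasure (measure_pmf nu) (X \<inter> carrier G)"
    unfolding nu_measure_def by (rule emeasure_restrict_space) auto
  finally have "measure steps {\<omega> \<in> space steps. \<omega> j \<in> X} = measure (measure_pmf nu) (X \<inter> carrier G)"
    unfolding measure_def by simp
  then show ?thesis
    unfolding null[symmetric] .
qed

lemma prob_identity_pos: "0 < measure steps {\<omega> \<in> space steps. \<omega> 0 = \<one>}"
proof -
  obtain i where i: "1 \<le> i" "c i = \<one>"
    using c_enum one_closed by (metis imageE atLeast_iff)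
  have "i \<in> set_pmf K_pmf"
    using i(1) K_const_pos by (simp add: set_pmf_iff pmf_K)
  moreover have "True \<in> set_pmf (bernoulli_pmf ((1/2) ^ i))"
    by (simp add: set_pmf_iff pmf_bernoulli_True power_le_one)
  ultimately have "\<one> \<in> set_pmf nu"
    using i(2) unfolding nu_def by (force simp: set_bind_pmf)
  then have "0 < measure (measure_pmf nu) {\<one>}"
    by (simp add: measure_pmf_single pmf_positive)
  then show ?thesis
    using measure_step[of 0 "{\<one>}"] by simp
qed

lemma step_average_integrable:
  assumes "\<And>h. h \<in> carrier G \<Longrightarrow> \<bar>u h\<bar> \<le> B" "g \<in> carrier G"
  shows "integrable steps (\<lambda>\<omega>. u (g \<otimes> \<omega> 0) :: real)"
proof (rule steps.P.integrable_const_bound[of _ B])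
  show "AE \<omega> in steps. norm (u (g \<otimes> \<omega> 0)) \<le> B"
    using assms by (intro AE_I2) (simp add: in_space_steps)
  show "(\<lambda>\<omega>. u (g \<otimes> \<omega> 0)) \<in> borel_measurable steps"
    using measurable_compose[OF measurable_step, of "\<lambda>h. u (g \<otimes> h)" borel] by simp
qed

text \<open>Suppose that the drop \<open>d n g = u n g - u (Suc n) g\<close> has supremum \<open>s > 0\<close>. As \<open>d\<close> is harmonic and
  the walk rests with probability \<open>\<alpha> > 0\<close>, a point where \<open>d\<close> is within \<open>\<epsilon>\<close> of \<open>s\<close> is followed, at the
  same \<open>g\<close>, by one where it is within \<open>\<epsilon> / \<alpha>\<close>. Starting close enough to \<open>s\<close>, the drop stays above \<open>s / 2\<close>
  for arbitrarily many steps, and the bounded function \<open>u\<close> cannot fall that far.\<close>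

lemma space_time_harmonic_decreasing:
  fixes u :: "nat \<Rightarrow> 'a \<Rightarrow> real"
  assumes bound: "\<And>n g. g \<in> carrier G \<Longrightarrow> \<bar>u n g\<bar> \<le> 1"
    and harmonic: "\<And>n g. g \<in> carrier G \<Longrightarrow> u n g = (\<integral>\<omega>. u (Suc n) (g \<otimes> \<omega> 0) \<partial>steps)"
    and g\<^sub>0: "g\<^sub>0 \<in> carrier G"
  shows "u n\<^sub>0 g\<^sub>0 \<le> u (Suc n\<^sub>0) g\<^sub>0"
proof (rule ccontr)
  assume neg: "\<not> u n\<^sub>0 g\<^sub>0 \<le> u (Suc n\<^sub>0) g\<^sub>0"
  define d where "d n g = u n g - u (Suc n) g" for n g
  define \<D> where "\<D> = {d n g | n g. g \<in> carrier G}"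
  define s where "s = Sup \<D>"
  define \<alpha> where "\<alpha> = measure steps {\<omega> \<in> space steps. \<omega> 0 = \<one>}"
  have \<alpha>: "0 < \<alpha>"
    unfolding \<alpha>_def by (rule prob_identity_pos)
  have d_bound: "\<bar>d n g\<bar> \<le> 2" if "g \<in> carrier G" for n g
    using bound[OF that, of n] bound[OF that, of "Suc n"] unfolding d_def by linarith
  have bdd: "bdd_above \<D>"
    unfolding \<D>_def bdd_above_def using d_bound by (intro exI[of _ 2]) (auto simp: abs_le_iff)
  have d_le: "d n g \<le> s" if "g \<in> carrier G" for n g
    unfolding s_def using bdd that by (intro cSup_upper) (auto simp: \<D>_def)
  have s: "0 < s"
    using neg d_le[OF g\<^sub>0, of n\<^sub>0] by (simp add: d_def)
  have id_event: "{\<omega> \<in> space steps. \<omega> 0 = \<one>} \<in> sets steps"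
    using measurable_sets[OF measurable_step[of 0], of "{\<one>}"]
    by (simp add: vimage_def Int_def conj_commute)
  have lazy: "(s - d (Suc n) g) * \<alpha> \<le> s - d n g" if g: "g \<in> carrier G" for n g
  proof -
    let ?I = "indicator {\<omega> \<in> space steps. \<omega> 0 = \<one>} :: _ \<Rightarrow> real"
    have int: "integrable steps (\<lambda>\<omega>. u m (g \<otimes> \<omega> 0))" "integrable steps (\<lambda>\<omega>. d m (g \<otimes> \<omega> 0))" for m
      using step_average_integrable[of "u m" 1, OF bound g] step_average_integrable[of "d m" 2, OF d_bound g]
      by simp_all
    have intI: "integrable steps (\<lambda>\<omega>. s + (d (Suc n) g - s) * ?I \<omega>)"
      using id_event by (intro Bochner_Integration.integrable_add) (auto simp: less_top[symmetric])
    have "d n g = (\<integral>\<omega>. d (Suc n) (g \<otimes> \<omega> 0) \<partial>steps)"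
      unfolding d_def harmonic[OF g, of n] harmonic[OF g, of "Suc n"]
      by (rule Bochner_Integration.integral_diff[symmetric]) (rule int)+
    also have "\<dots> \<le> (\<integral>\<omega>. s + (d (Suc n) g - s) * ?I \<omega> \<partial>steps)"
      using g d_le by (intro integral_mono int intI) (auto simp: in_space_steps indicator_def)
    also have "\<dots> = s + (d (Suc n) g - s) * \<alpha>"
      using id_event
      by (subst Bochner_Integration.integral_add) (auto simp: \<alpha>_def steps.P.prob_space less_top[symmetric])
    finally show ?thesis
      by (simp add: algebra_simps)
  qed
  have iterate: "(s - d (n + i) g) * \<alpha> ^ i \<le> s - d n g" if g: "g \<in> carrier G" for n g i
  proof (induction i)
    case (Suc i)
    have "(s - d (n + Suc i) g) * \<alpha> ^ Suc i = ((s - d (Suc (n + i)) g) * \<alpha>) * \<alpha> ^ i"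
      by simp
    also have "\<dots> \<le> (s - d (n + i) g) * \<alpha> ^ i"
      using lazy[OF g, of "n + i"] \<alpha> by (intro mult_right_mono) auto
    finally show ?case
      using Suc by linarith
  qed simp
  \<comment> \<open>\<open>L\<close> drops of size \<open>s / 2\<close> exceed \<open>2\<close>, the largest possible variation of \<open>u\<close>.\<close>
  obtain L :: nat where L: "4 / s < real L"
    using reals_Archimedean2 by blast
  have \<alpha>1: "\<alpha> \<le> 1"
    by (simp add: \<alpha>_def)
  have "s - s / 2 * \<alpha> ^ L < s"
    using s \<alpha> by simp
  moreover have "\<D> \<noteq> {}"
    using g\<^sub>0 by (auto simp: \<D>_def)
  ultimately obtain x where "x \<in> \<D>" "s - s / 2 * \<alpha> ^ L < x"
    using less_cSupD[of \<D> "s - s / 2 * \<alpha> ^ L"] unfolding s_def[symmetric] by blast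
  then obtain n g where g: "g \<in> carrier G" and close: "s - s / 2 * \<alpha> ^ L < d n g"
    unfolding \<D>_def by blast
  have large: "s / 2 \<le> d (n + i) g" if "i < L" for i
  proof -
    have "(s - d (n + i) g) * \<alpha> ^ L \<le> (s - d (n + i) g) * \<alpha> ^ i"
      using d_le[OF g] \<alpha> \<alpha>1 that by (intro mult_left_mono power_decreasing) auto
    also have "\<dots> < s / 2 * \<alpha> ^ L"
      using iterate[OF g, of n i] close by linarith
    finally show ?thesis
      using \<alpha> by simp
  qed
  have "u n g - u (n + L) g = (\<Sum>i<L. d (n + i) g)"
    unfolding d_def using sum_lessThan_telescope'[of "\<lambda>i. u (n + i) g" L] by simp
  also have "\<dots> \<ge> (\<Sum>i<L. s / 2)"
    using large by (intro sum_mono) simp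
  finally have "real L * (s / 2) \<le> u n g - u (n + L) g"
    by simp
  moreover have "2 < real L * (s / 2)"
    using L s by (simp add: field_simps)
  ultimately show False
    using bound[OF g, of n] bound[OF g, of "n + L"] by linarith
qed

lemma space_time_harmonic_constant_in_time:
  fixes u :: "nat \<Rightarrow> 'a \<Rightarrow> real"
  assumes bound: "\<And>n g. g \<in> carrier G \<Longrightarrow> \<bar>u n g\<bar> \<le> 1"
    and harmonic: "\<And>n g. g \<in> carrier G \<Longrightarrow> u n g = (\<integral>\<omega>. u (Suc n) (g \<otimes> \<omega> 0) \<partial>steps)"
    and g: "g \<in> carrier G"
  shows "u n g = u 0 g"
proof (induction n)
  case (Suc n)
  have "- u n g \<le> - u (Suc n) g"
  proof (rule space_time_harmonic_decreasing[of "\<lambda>n g. - u n g", OF _ _ g])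
    show "\<bar>- u n g\<bar> \<le> 1" if "g \<in> carrier G" for n g
      using bound[OF that] by simp
    show "- u n g = (\<integral>\<omega>. - u (Suc n) (g \<otimes> \<omega> 0) \<partial>steps)" if "g \<in> carrier G" for n g
      using harmonic[OF that, of n] by simp
  qed
  moreover have "u n g \<le> u (Suc n) g"
    using assms by (rule space_time_harmonic_decreasing[of u])
  ultimately show ?case
    using Suc by simp
qed simp

lemma tail_prob_constant_in_time:
  assumes "T \<in> tail_algebra" "g \<in> carrier G"
  shows "tail_prob T n g = tail_prob T 0 g"
proof (rule space_time_harmonic_constant_in_time[of "tail_prob T", OF _ _ assms(2)])
  show "\<bar>tail_prob T n g\<bar> \<le> 1" for n g
    using tail_prob_bounds[of T n g] by linarith
qed (rule tail_prob_harmonic[OF assms(1)])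

section \<open>Convergence along the walk\<close>

lemma tail_prob_Compl:
  assumes T: "T \<in> tail_algebra" and g: "g \<in> carrier G"
  shows "tail_prob (space path_algebra - T) n g = 1 - tail_prob T n g"
proof -
  have "{\<omega> \<in> space steps. path_from n g \<omega> \<in> space path_algebra - T} =
      space steps - {\<omega> \<in> space steps. path_from n g \<omega> \<in> T}"
    using measurable_space[OF measurable_path_from[OF g, of n]] by blast
  then show ?thesis
    unfolding tail_prob_def using steps.P.prob_compl[OF path_from_event[OF T g]] by simp
qed

lemma determined_before_pos: "determined_before n {\<omega> \<in> space steps. P (pos \<omega> n)}"
  unfolding determined_before_def
proof (intro ballI impI)
  fix \<omega> \<omega>' assume "\<omega>' \<in> space steps" "\<forall>j<n. \<omega> j = \<omega>' j" "\<omega> \<in> {\<omega> \<in> space steps. P (pos \<omega> n)}"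
  then show "\<omega>' \<in> {\<omega> \<in> space steps. P (pos \<omega> n)}"
    using pos_cong[of n \<omega> \<omega>'] by simp
qed

lemma pos_event: "{\<omega> \<in> space steps. P (pos \<omega> n)} \<in> sets steps"
  using measurable_compose[OF measurable_pos[of n], of P "count_space UNIV"] by (simp add: pred_def)

text \<open>Doob's maximal inequality in a special case: \<open>C\<close> is split according to the first time \<open>n \<ge> N\<close> at
  which the conditional probability of \<open>T\<close> is at most \<open>1/2\<close>. On each piece \<open>T\<close> fails with conditional
  probability at least \<open>1/2\<close>.\<close>

lemma first_failure_bound:
  assumes T: "T \<in> tail_algebra" and C: "C \<in> sets steps" "determined_before N C"
  defines "E \<equiv> {\<omega> \<in> space steps. path \<omega> \<in> T}"
  shows "measure steps (\<Union>n\<in>{N..}. {\<omega> \<in> C. tail_prob T 0 (pos \<omega> n) \<le> 1/2}) \<le> 2 * measure steps (C - E)"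
proof -
  define fails where "fails n = {\<omega> \<in> space steps. tail_prob T 0 (pos \<omega> n) \<le> 1/2}" for n
  define B where "B n = (if N \<le> n then C \<inter> fails n - (\<Union>i\<in>{N..<n}. fails i) else {})" for n
  have fails: "fails n \<in> sets steps" "determined_before n (fails n)" for n
    unfolding fails_def by (rule pos_event determined_before_pos)+
  have B_sets: "B n \<in> sets steps" for n
    using C(1) fails(1) by (auto simp: B_def)
  have B_det: "determined_before n (B n)" for n
  proof (cases "N \<le> n")
    case True
    have "determined_before n C" "determined_before n (fails i)" if "i \<le> n" for i
      using determined_before_mono[OF C(2) True] determined_before_mono[OF fails(2) that] by auto
    then have "determined_before n C" "\<And>i. i \<in> {N..<n} \<Longrightarrow> determined_before n (fails i)"
      by auto
    note det = this fails(2)[of n]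
    show ?thesis
      unfolding determined_before_def
    proof (intro ballI impI)
      fix \<omega> \<omega>' assume \<omega>: "\<omega> \<in> space steps" "\<omega>' \<in> space steps" "\<forall>j<n. \<omega> j = \<omega>' j" "\<omega> \<in> B n"
      have "\<omega> \<in> X \<longleftrightarrow> \<omega>' \<in> X" if "determined_before n X" for X
        using determined_before_iff[OF that \<omega>(1,2)] \<omega>(3) by blast
      then show "\<omega>' \<in> B n"
        using det \<omega>(4) True unfolding B_def by auto
    qed
  qed (simp add: B_def determined_before_def)
  have E: "E \<in> sets steps"
    using measurable_sets[OF measurable_path tail_in_path_sets[OF T]]
    by (simp add: E_def vimage_def Int_def conj_commute)
  have B_bound: "measure steps (B n) \<le> 2 * measure steps (B n - E)" for n
  proof -
    have E_eq: "E = {\<omega> \<in> space steps. path_from 0 \<one> \<omega> \<in> T}"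
      unfolding E_def using path_from_start by auto
    have "measure steps (B n \<inter> E) = (\<integral>\<omega>. indicator (B n) \<omega> * tail_prob T (0 + n) (\<one> \<otimes> pos \<omega> n) \<partial>steps)"
      unfolding E_eq by (rule markov_property[OF T one_closed B_sets B_det])
    also have "\<dots> \<le> (\<integral>\<omega>. indicator (B n) \<omega> * (1/2) \<partial>steps)"
    proof (rule integral_mono)
      show "integrable steps (\<lambda>\<omega>. indicator (B n) \<omega> * tail_prob T (0 + n) (\<one> \<otimes> pos \<omega> n))"
        using B_sets measurable_tail_prob_pos tail_prob_bounds
        by (intro steps.P.integrable_const_bound[of _ 1]) (auto simp: indicator_def)
      show "integrable steps (\<lambda>\<omega>. indicator (B n) \<omega> * (1/2) :: real)"
        using B_sets by (auto simp: less_top[symmetric])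
      fix \<omega> assume "\<omega> \<in> space steps"
      then have "pos \<omega> n \<in> carrier G"
        using pos_closed by (simp add: in_space_steps)
      then show "indicator (B n) \<omega> * tail_prob T (0 + n) (\<one> \<otimes> pos \<omega> n) \<le> indicator (B n) \<omega> * (1/2)"
        using tail_prob_constant_in_time[OF T, of "pos \<omega> n" n]
        by (auto simp: indicator_def B_def fails_def split: if_splits)
    qed
    also have "\<dots> = measure steps (B n) / 2"
      using B_sets by simp
    finally have "measure steps (B n \<inter> E) \<le> measure steps (B n) / 2" .
    moreover have "measure steps (B n) = measure steps (B n \<inter> E) + measure steps (B n - E)"
      using steps.P.finite_measure_Union[of "B n \<inter> E" "B n - E"] B_sets E
      by (simp add: Int_Diff_disjoint Int_Diff_Un)
    ultimately show ?thesis by linarith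
  qed
  have disj: "disjoint_family B"
  proof -
    have "B m \<inter> B n = {}" if "m < n" for m n
      using that by (auto simp: B_def)
    then show ?thesis
      unfolding disjoint_family_on_def by (metis Int_commute linorder_neqE_nat)
  qed
  have disj': "disjoint_family (\<lambda>n. B n - E)"
    using disj unfolding disjoint_family_on_def by blast
  have sums_B: "(\<lambda>n. measure steps (B n)) sums measure steps (\<Union>n. B n)"
    using B_sets by (intro steps.P.finite_measure_UNION disj) auto
  have sums_B': "(\<lambda>n. measure steps (B n - E)) sums measure steps (\<Union>n. B n - E)"
    using B_sets E by (intro steps.P.finite_measure_UNION disj') auto
  have "(\<Union>n\<in>{N..}. {\<omega> \<in> C. tail_prob T 0 (pos \<omega> n) \<le> 1/2}) \<subseteq> (\<Union>n. B n)"
  proof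
    fix \<omega> assume "\<omega> \<in> (\<Union>n\<in>{N..}. {\<omega> \<in> C. tail_prob T 0 (pos \<omega> n) \<le> 1/2})"
    then have \<omega>: "\<omega> \<in> C" "\<exists>n. N \<le> n \<and> \<omega> \<in> fails n"
      using sets.sets_into_space[OF C(1)] by (auto simp: fails_def)
    define n where "n = (LEAST n. N \<le> n \<and> \<omega> \<in> fails n)"
    have "N \<le> n \<and> \<omega> \<in> fails n"
      unfolding n_def using \<omega>(2) by (rule LeastI_ex)
    moreover have "\<omega> \<notin> fails i" if "i \<in> {N..<n}" for i
      using not_less_Least[of i "\<lambda>n. N \<le> n \<and> \<omega> \<in> fails n"] that unfolding n_def by auto
    ultimately have "\<omega> \<in> B n"
      using \<omega>(1) by (auto simp: B_def)
    then show "\<omega> \<in> (\<Union>n. B n)" by blast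
  qed
  then have "measure steps (\<Union>n\<in>{N..}. {\<omega> \<in> C. tail_prob T 0 (pos \<omega> n) \<le> 1/2}) \<le> measure steps (\<Union>n. B n)"
    using B_sets by (intro steps.P.finite_measure_mono) auto
  also have "\<dots> = (\<Sum>n. measure steps (B n))"
    using sums_unique[OF sums_B] .
  also have "\<dots> \<le> (\<Sum>n. 2 * measure steps (B n - E))"
    using B_bound sums_summable[OF sums_B] sums_summable[OF sums_B']
    by (intro suminf_le summable_mult) auto
  also have "\<dots> = 2 * measure steps (\<Union>n. B n - E)"
    using suminf_mult[OF sums_summable[OF sums_B']] sums_unique[OF sums_B'] by simp
  also have "\<dots> \<le> 2 * measure steps (C - E)"
    using C(1) E by (intro mult_left_mono steps.P.finite_measure_mono) (auto simp: B_def split: if_splits)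
  finally show ?thesis .
qed

text \<open>Levy's zero-one law, in the form needed: \<open>first_failure_bound\<close> is applied to a finitely determined
  \<open>C\<close> that nearly coincides with the event that the path is in \<open>T\<close>.\<close>

lemma tail_prob_eventually_large:
  assumes T: "T \<in> tail_algebra"
  shows "AE \<omega> in steps. path \<omega> \<in> T \<longrightarrow> (\<forall>\<^sub>F n in sequentially. 1/2 < tail_prob T 0 (pos \<omega> n))"
proof -
  define E where "E = {\<omega> \<in> space steps. path \<omega> \<in> T}"
  define fails where "fails n = {\<omega> \<in> space steps. tail_prob T 0 (pos \<omega> n) \<le> 1/2}" for n
  define Bad where "Bad = E \<inter> (\<Inter>N. \<Union>n\<in>{N..}. fails n)"
  have fails: "fails n \<in> sets steps" for n
    unfolding fails_def by (rule pos_event)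
  have E: "E \<in> sets steps"
    using measurable_sets[OF measurable_path tail_in_path_sets[OF T]]
    by (simp add: E_def vimage_def Int_def conj_commute)
  have Bad: "Bad \<in> sets steps"
    unfolding Bad_def using E fails by (intro sets.Int sets.countable_INT sets.countable_UN) auto
  have "measure steps Bad \<le> 0 + \<epsilon>" if "0 < \<epsilon>" for \<epsilon>
  proof -
    obtain N C where C: "C \<in> sets steps" "determined_before N C"
      "measure steps (sym_diff E C) < \<epsilon> / 3"
      using approximation_by_finitely_determined[OF E, of "\<epsilon> / 3"] \<open>0 < \<epsilon>\<close> by auto
    let ?U = "\<Union>n\<in>{N..}. {\<omega> \<in> C. tail_prob T 0 (pos \<omega> n) \<le> 1/2}"
    have U_eq: "?U = (\<Union>n\<in>{N..}. C \<inter> fails n)"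
      using sets.sets_into_space[OF C(1)] by (auto simp: fails_def)
    have U: "?U \<in> sets steps"
      unfolding U_eq using C(1) fails by auto
    have "measure steps Bad \<le> measure steps ((E - C) \<union> ?U)"
      using E C(1) U unfolding U_eq by (intro steps.P.finite_measure_mono) (auto simp: Bad_def)
    also have "\<dots> \<le> measure steps (E - C) + measure steps ?U"
      using E C(1) U by (intro measure_Un_le) auto
    also have "\<dots> \<le> measure steps (E - C) + 2 * measure steps (C - E)"
      using first_failure_bound[OF T C(1,2)] by (simp add: E_def)
    also have "\<dots> \<le> 3 * measure steps (sym_diff E C)"
    proof -
      have "measure steps (E - C) \<le> measure steps (sym_diff E C)"
        "measure steps (C - E) \<le> measure steps (sym_diff E C)"
        using E C(1) by (auto intro!: steps.P.finite_measure_mono)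
      then show ?thesis by linarith
    qed
    finally show ?thesis
      using C(3) by simp
  qed
  then have "measure steps Bad \<le> 0"
    by (rule field_le_epsilon)
  then have "measure steps Bad = 0"
    by (intro antisym) simp_all
  then have "Bad \<in> null_sets steps"
    using Bad by (intro null_setsI) (simp_all add: steps.P.emeasure_eq_measure)
  moreover have "{\<omega> \<in> space steps. \<not> (path \<omega> \<in> T \<longrightarrow>
      (\<forall>\<^sub>F n in sequentially. 1/2 < tail_prob T 0 (pos \<omega> n)))} \<subseteq> Bad"
    by (auto simp: Bad_def E_def fails_def eventually_sequentially not_less)
  ultimately show ?thesis
    by (rule AE_I')
qed

section \<open>The distribution of levels\<close>

text \<open>The law of an increment, conditioned on its index; the two summands are the red and the blue case.\<close>

lemma emeasure_nu:
  "emeasure (measure_pmf nu) X = (\<integral>\<^sup>+i. indicator X (c i) * ennreal ((1/2) ^ i) +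
     emeasure (measure_pmf (pmf_of_set (b i <# set_inv (F i)))) X * ennreal (1 - (1/2) ^ i) \<partial>K_pmf)"
proof -
  have "emeasure (measure_pmf (bind_pmf (bernoulli_pmf ((1/2) ^ i)) (\<lambda>red.
       if red then return_pmf (c i) else pmf_of_set (b i <# set_inv (F i))))) X =
     indicator X (c i) * ennreal ((1/2) ^ i) +
     emeasure (measure_pmf (pmf_of_set (b i <# set_inv (F i)))) X * ennreal (1 - (1/2) ^ i)" for i
    by (simp add: emeasure_bind_pmf nn_integral_bernoulli_pmf power_le_one)
  then show ?thesis
    unfolding nu_def emeasure_bind_pmf by simp
qed

lemma AE_K: "AE i in measure_pmf K_pmf. 1 \<le> i"
  by (auto simp: AE_measure_pmf_iff set_pmf_iff pmf_K split: if_splits)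

lemma set_pmf_blue_step:
  assumes "1 \<le> i"
  shows "set_pmf (pmf_of_set (b i <# set_inv (F i))) = b i <# set_inv (F i)"
  using F_props[OF assms] by (intro set_pmf_of_set) (auto simp: l_coset_def SET_INV_def)

lemma blue_step_outside:
  assumes "1 \<le> i" "\<And>g. level g = i \<Longrightarrow> is_blue g \<Longrightarrow> g \<notin> X"
  shows "emeasure (measure_pmf (pmf_of_set (b i <# set_inv (F i)))) X = 0"
proof -
  have "measure (measure_pmf (pmf_of_set (b i <# set_inv (F i)))) X = 0"
    unfolding measure_pmf_zero_iff set_pmf_blue_step[OF assms(1)]
    using assms level_blue_step[OF assms(1)] by (force simp: is_blue_def)
  then show ?thesis
    by (simp add: measure_pmf.emeasure_eq_measure)
qed

lemma blue_step_inside: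
  assumes "1 \<le> i" "\<And>g. level g = i \<Longrightarrow> g \<in> X"
  shows "emeasure (measure_pmf (pmf_of_set (b i <# set_inv (F i)))) X = 1"
  using assms level_blue_step[OF assms(1)]
  by (intro measure_pmf.emeasure_eq_1_AE) (auto simp: AE_measure_pmf_iff set_pmf_blue_step)

lemma red_step_bound:
  assumes "1 \<le> i" "\<And>g. g \<in> X \<Longrightarrow> n \<le> level g"
  shows "indicator X (c i) * ennreal ((1/2) ^ i) \<le> ennreal ((1/2) ^ n)"
proof (cases "c i \<in> X")
  case True
  then have "n \<le> i"
    using assms level_le[OF c_in_A[OF assms(1)]] by fastforce
  then show ?thesis
    using True by (simp add: power_decreasing)
qed simp

lemma prob_red_level: "measure (measure_pmf nu) {g. n \<le> level g \<and> \<not> is_blue g} \<le> (1/2) ^ n"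
proof -
  let ?X = "{g. n \<le> level g \<and> \<not> is_blue g}"
  have "emeasure (measure_pmf nu) ?X \<le> (\<integral>\<^sup>+i. ennreal ((1/2) ^ n) \<partial>K_pmf)"
    unfolding emeasure_nu
  proof (rule nn_integral_mono_AE, use AE_K in eventually_elim)
    case (elim i)
    then show ?case
      using red_step_bound[of i ?X n] blue_step_outside[of i ?X] by simp
  qed
  then show ?thesis
    by (simp add: measure_pmf.emeasure_eq_measure)
qed

lemma prob_level_eq:
  assumes "1 \<le> k"
  shows "measure (measure_pmf nu) {g. level g = k} \<le> real k powr (-5/4) / K_const + (1/2) ^ k"
proof -
  let ?X = "{g. level g = k}"
  have "emeasure (measure_pmf nu) ?X \<le> (\<integral>\<^sup>+i. indicator {k} i + ennreal ((1/2) ^ k) \<partial>K_pmf)"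
    unfolding emeasure_nu
  proof (rule nn_integral_mono_AE, use AE_K in eventually_elim)
    case (elim i)
    have blue: "emeasure (measure_pmf (pmf_of_set (b i <# set_inv (F i)))) ?X * ennreal (1 - (1/2) ^ i)
        \<le> indicator {k} i"
    proof (cases "i = k")
      case True
      have "emeasure (measure_pmf (pmf_of_set (b i <# set_inv (F i)))) ?X * ennreal (1 - (1/2) ^ i) \<le> 1 * 1"
        by (intro mult_mono measure_pmf.emeasure_le_1) auto
      then show ?thesis using True by simp
    qed (use blue_step_outside[of i ?X] elim in simp)
    have "indicator ?X (c i) * ennreal ((1/2) ^ i) \<le> ennreal ((1/2) ^ k)"
      using red_step_bound[of i ?X k] elim by simp
    from add_mono[OF this blue] show ?case
      by (simp add: add.commute)
  qed
  also have "\<dots> = ennreal (pmf K_pmf k) + ennreal ((1/2) ^ k)"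
    by (subst nn_integral_add) (auto simp: emeasure_pmf_single)
  also have "\<dots> = ennreal (real k powr (-5/4) / K_const + (1/2) ^ k)"
    using assms K_const_pos by (simp add: pmf_K ennreal_plus[symmetric] del: ennreal_plus)
  finally have "ennreal (measure (measure_pmf nu) ?X) \<le> ennreal (real k powr (-5/4) / K_const + (1/2) ^ k)"
    unfolding measure_pmf.emeasure_eq_measure .
  then show ?thesis
    using K_const_pos by (subst (asm) ennreal_le_iff) auto
qed

text \<open>At least half of the mass of each index is blue, and the indices from \<open>n\<close> to \<open>2n - 1\<close> alone give
  \<open>n \<sqdot> (2n)\<^sup>-\<^sup>5\<^sup>/\<^sup>4\<close> up to the normalising constant.\<close>

lemma prob_level_ge:
  assumes "1 \<le> n"
  shows "2 powr (-9/4) / K_const * real n powr (-1/4) \<le> measure (measure_pmf nu) {g. n \<le> level g}"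
proof -
  let ?X = "{g. n \<le> level g}"
  have K: "real n powr (-1/4) * (2 powr (-5/4) / K_const) \<le> measure (measure_pmf K_pmf) {n..<2*n}"
  proof -
    have "real n powr (-1/4) = real n powr 1 * real n powr (-5/4)"
      by (subst powr_add[symmetric]) simp
    then have "real n powr (-1/4) * (2 powr (-5/4) / K_const) = real n * (real (2 * n) powr (-5/4) / K_const)"
      using assms by (simp add: powr_mult)
    also have "\<dots> = (\<Sum>k\<in>{n..<2*n}. real (2 * n) powr (-5/4) / K_const)"
      by simp
    also have "\<dots> \<le> (\<Sum>k\<in>{n..<2*n}. pmf K_pmf k)"
    proof (rule sum_mono)
      fix k assume k: "k \<in> {n..<2*n}"
      then have "real (2 * n) powr (-5/4) \<le> real k powr (-5/4)"
        using assms by (intro powr_mono2') auto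
      then show "real (2 * n) powr (-5/4) / K_const \<le> pmf K_pmf k"
        using k assms K_const_pos by (simp add: pmf_K divide_right_mono)
    qed
    also have "\<dots> = measure (measure_pmf K_pmf) {n..<2*n}"
      by (simp add: measure_measure_pmf_finite)
    finally show ?thesis .
  qed
  have "ennreal (measure (measure_pmf K_pmf) {n..<2*n} / 2) = (\<integral>\<^sup>+i. indicator {n..<2*n} i * ennreal (1/2) \<partial>K_pmf)"
  proof -
    have "ennreal (measure (measure_pmf K_pmf) {n..<2*n} / 2) =
        emeasure (measure_pmf K_pmf) {n..<2*n} * ennreal (1/2)"
      unfolding measure_pmf.emeasure_eq_measure by (subst ennreal_mult[symmetric]) simp_all
    also have "\<dots> = (\<integral>\<^sup>+i. indicator {n..<2*n} i * ennreal (1/2) \<partial>K_pmf)"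
      by (subst nn_integral_multc) simp_all
    finally show ?thesis .
  qed
  also have "\<dots> \<le> emeasure (measure_pmf nu) ?X"
    unfolding emeasure_nu
  proof (rule nn_integral_mono_AE, use AE_K in eventually_elim)
    case (elim i)
    show ?case
    proof (cases "i \<in> {n..<2*n}")
      case True
      have "(1/2 :: real) ^ i \<le> (1/2) ^ 1"
        using elim by (intro power_decreasing) auto
      then have "ennreal (1/2) \<le> ennreal (1 - (1/2) ^ i)"
        by (intro ennreal_leI) simp
      also have "\<dots> = emeasure (measure_pmf (pmf_of_set (b i <# set_inv (F i)))) ?X * ennreal (1 - (1/2) ^ i)"
        using blue_step_inside[of i ?X] True elim by simp
      also have "\<dots> \<le> indicator ?X (c i) * ennreal ((1/2) ^ i) + \<dots>"
        by simp
      finally show ?thesis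
        using True by simp
    qed simp
  qed
  finally have "measure (measure_pmf K_pmf) {n..<2*n} / 2 \<le> measure (measure_pmf nu) ?X"
    by (simp add: measure_pmf.emeasure_eq_measure)
  moreover have "2 powr (-5/4) = 2 * (2::real) powr (-9/4)"
    using powr_diff[of "2::real" "-5/4" 1] by simp
  then have "real n powr (-1/4) * (2 powr (-5/4) / K_const) =
      2 * (2 powr (-9/4) / K_const * real n powr (-1/4))"
    by simp
  ultimately show ?thesis
    using K by linarith
qed

section \<open>Almost every trajectory eventually has peaks\<close>

text \<open>The three ways in which the first increments can fail to have a peak; \<open>tie\<close> and \<open>red_record\<close>
  speak of the newest increment, so that each failure is charged to the time when it arises.\<close>

definition low :: "nat \<Rightarrow> (nat \<Rightarrow> 'a) \<Rightarrow> bool" where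
  "low i \<omega> \<longleftrightarrow> (\<forall>j<i. level (\<omega> j) < i)"

definition tie :: "nat \<Rightarrow> (nat \<Rightarrow> 'a) \<Rightarrow> bool" where
  "tie i \<omega> \<longleftrightarrow> (\<exists>j<i. level (\<omega> j) = level (\<omega> i)) \<and> (\<forall>j<i. level (\<omega> j) \<le> level (\<omega> i)) \<and> i \<le> level (\<omega> i)"

definition red_record :: "nat \<Rightarrow> (nat \<Rightarrow> 'a) \<Rightarrow> bool" where
  "red_record i \<omega> \<longleftrightarrow> i \<le> level (\<omega> i) \<and> \<not> is_blue (\<omega> i)"

text \<open>After the last failure at time \<open>N\<close> the maximal level still has to exceed the levels of the first \<open>N\<close>
  increments; from then on it is attained at a time past \<open>N\<close> only, where ties and red records are
  excluded.\<close>

lemma eventual_peaks: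
  assumes "\<And>i. N \<le> i \<Longrightarrow> \<not> low i \<omega> \<and> \<not> tie i \<omega> \<and> \<not> red_record i \<omega>"
  shows "\<exists>M. \<forall>i>M. \<exists>m. peak \<omega> i m"
proof -
  \<comment> \<open>The sum is a bound for the levels of the first \<open>N\<close> increments.\<close>
  define M where "M = N + (\<Sum>j<N. level (\<omega> j))"
  have M: "level (\<omega> j) \<le> M" if "j < N" for j
    unfolding M_def using that member_le_sum[of j "{..<N}" "\<lambda>j. level (\<omega> j)"] by simp
  have "\<exists>m. peak \<omega> i m" if "M < i" for i
  proof -
    have i: "N \<le> i"
      using that by (simp add: M_def)
    define k where "k = Max ((\<lambda>j. level (\<omega> j)) ` {..<i})"
    have le: "level (\<omega> j) \<le> k" if "j < i" for j
      unfolding k_def using that by (intro Max_ge) auto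
    have "{..<i} \<noteq> {}"
      using that by auto
    then have "k \<in> (\<lambda>j. level (\<omega> j)) ` {..<i}"
      unfolding k_def by (intro Max_in) auto
    then obtain m where m: "m < i" "level (\<omega> m) = k"
      by auto
    have k: "i \<le> k"
      using assms[OF i] le unfolding low_def by (meson le_trans not_le)
    have late: "N \<le> j" if "level (\<omega> j) = k" for j
      using M[of j] that k \<open>M < i\<close> by (metis le_trans not_le)
    have unique: "\<not> (j < j' \<and> level (\<omega> j) = k \<and> level (\<omega> j') = k)" if "j' < i" for j j'
    proof
      assume j: "j < j' \<and> level (\<omega> j) = k \<and> level (\<omega> j') = k"
      then have "tie j' \<omega>"
        unfolding tie_def using le that k by (auto intro: order_trans)
      then show False
        using assms late j by blast
    qed
    have "level (\<omega> j) < k" if "j < i" "j \<noteq> m" for j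
      using le[OF that(1)] unique[OF that(1), of m] unique[OF m(1), of j] m that
      by (metis linorder_neqE_nat le_neq_implies_less)
    moreover have "is_blue (\<omega> m)"
      using assms[OF late[OF m(2)]] m k unfolding red_record_def by auto
    ultimately have "peak \<omega> i m"
      using m k by (simp add: peak_def)
    then show ?thesis ..
  qed
  then show ?thesis by blast
qed

lemma measurable_level [measurable]: "(\<lambda>\<omega>. level (\<omega> j)) \<in> steps \<rightarrow>\<^sub>M count_space UNIV"
  using measurable_compose[OF measurable_step[of j], of level "count_space UNIV"] by simp

lemma pred_is_blue [measurable]: "Measurable.pred steps (\<lambda>\<omega>. is_blue (\<omega> j))"
  using measurable_compose[OF measurable_step[of j], of is_blue "count_space UNIV"] by simp

lemma bad_events:
  "{\<omega> \<in> space steps. low i \<omega>} \<in> sets steps"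
  "{\<omega> \<in> space steps. tie i \<omega>} \<in> sets steps"
  "{\<omega> \<in> space steps. red_record i \<omega>} \<in> sets steps"
  unfolding low_def tie_def red_record_def by measurable

lemma AE_not_red_record: "AE \<omega> in steps. \<forall>\<^sub>F i in sequentially. \<not> red_record i \<omega>"
proof -
  have "measure steps {\<omega> \<in> space steps. red_record i \<omega>} \<le> (1/2) ^ i" for i
    using measure_step[of i "{g. i \<le> level g \<and> \<not> is_blue g}"] prob_red_level[of i]
    by (simp add: red_record_def)
  then have "summable (\<lambda>i. measure steps {\<omega> \<in> space steps. red_record i \<omega>})"
    by (intro summable_comparison_test'[OF summable_geometric[of "1/2 :: real"], of 0]) auto
  then have "AE \<omega> in steps. \<forall>\<^sub>F i in sequentially. \<omega> \<in> space steps - {\<omega> \<in> space steps. red_record i \<omega>}"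
    by (intro borel_cantelli_AE1 bad_events) (auto simp: less_top[symmetric])
  then show ?thesis
    by (auto elim!: eventually_mono)
qed

lemma prob_low:
  assumes "1 \<le> i"
  shows "measure steps {\<omega> \<in> space steps. low i \<omega>} \<le>
    exp (- (2 powr (-9/4) / K_const * real i powr (-1/4))) ^ i"
proof -
  let ?X = "{g \<in> carrier G. level g < i}" and ?q = "2 powr (-9/4) / K_const * real i powr (-1/4)"
  have "{\<omega> \<in> space steps. low i \<omega>} = {\<omega> \<in> space steps. \<forall>j\<in>{..<i}. \<omega> j \<in> ?X}"
    by (auto simp: low_def in_space_steps)
  then have "emeasure steps {\<omega> \<in> space steps. low i \<omega>} = (\<Prod>j\<in>{..<i}. emeasure nu_measure ?X)"
    using steps.emeasure_PiM_Collect[of "{..<i}" "\<lambda>_. ?X"] by (simp add: sets_nu_measure)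
  also have "emeasure nu_measure ?X = emeasure (measure_pmf nu) ?X"
    unfolding nu_measure_def by (rule emeasure_restrict_space) auto
  also have "\<dots> = ennreal (measure (measure_pmf nu) ?X)"
    by (rule measure_pmf.emeasure_eq_measure)
  finally have eq: "measure steps {\<omega> \<in> space steps. low i \<omega>} = measure (measure_pmf nu) ?X ^ i"
    by (simp add: steps.P.emeasure_eq_measure ennreal_power)
  have "measure (measure_pmf nu) ?X \<le> measure (measure_pmf nu) (UNIV - {g. i \<le> level g})"
    by (intro measure_pmf.finite_measure_mono) auto
  also have "\<dots> = 1 - measure (measure_pmf nu) {g. i \<le> level g}"
    using measure_pmf.prob_compl[of "{g. i \<le> level g}" nu] by simp
  also have "\<dots> \<le> 1 - ?q"
    using prob_level_ge[OF assms] by simp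
  also have "\<dots> \<le> exp (- ?q)"
    using exp_ge_add_one_self[of "- ?q"] by simp
  finally show ?thesis
    unfolding eq by (intro power_mono) auto
qed

lemma AE_not_low: "AE \<omega> in steps. \<forall>\<^sub>F i in sequentially. \<not> low i \<omega>"
proof -
  define a where "a = 2 powr (-9/4) / K_const"
  have a: "0 < a"
    using K_const_pos by (simp add: a_def)
  have "(\<lambda>i::nat. exp (- (a * real i powr (-1/4))) ^ i) \<in> O(\<lambda>i. real i powr (-2))"
  proof -
    have "(\<lambda>i::nat. exp (- (real i * (a * real i powr (-1/4))))) \<in> O(\<lambda>i. real i powr (-2))"
      using a by real_asymp
    then show ?thesis
      by (simp add: exp_of_nat_mult[symmetric])
  qed
  then have "summable (\<lambda>i. exp (- (a * real i powr (-1/4))) ^ i)"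
    by (rule summable_comparison_test_bigo[rotated]) (simp add: summable_real_powr_iff)
  then have "summable (\<lambda>i. measure steps {\<omega> \<in> space steps. low i \<omega>})"
    using prob_low by (rule_tac summable_comparison_test'[of _ 1]) (auto simp: a_def)
  then have "AE \<omega> in steps. \<forall>\<^sub>F i in sequentially. \<omega> \<in> space steps - {\<omega> \<in> space steps. low i \<omega>}"
    by (intro borel_cantelli_AE1 bad_events) (auto simp: less_top[symmetric])
  then show ?thesis
    by (auto elim!: eventually_mono)
qed

text \<open>With the first \<open>i\<close> increments fixed, a tie requires the next level to hit the single value \<open>k\<close>,
  their maximum, and \<open>k \<ge> i\<close>. A union bound over pairs of increments would not be summable.\<close>

lemma prob_tie:
  assumes "1 \<le> i"
  shows "measure steps {\<omega> \<in> space steps. tie i \<omega>} \<le> real i powr (-5/4) / K_const + (1/2) ^ i" (is "_ \<le> ?B")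
proof -
  have B: "0 \<le> ?B"
    using K_const_pos by simp
  have inner: "emeasure steps {\<omega>' \<in> space steps. comb_seq i \<omega> \<omega>' \<in> {\<omega> \<in> space steps. tie i \<omega>}} \<le> ennreal ?B"
    for \<omega>
  proof -
    define k where "k = Max ((\<lambda>j. level (\<omega> j)) ` {..<i})"
    have sub: "level (\<omega>' 0) = k \<and> i \<le> k" if "tie i (comb_seq i \<omega> \<omega>')" for \<omega>'
    proof -
      have *: "\<exists>j<i. level (\<omega> j) = level (\<omega>' 0)" "\<forall>j<i. level (\<omega> j) \<le> level (\<omega>' 0)" "i \<le> level (\<omega>' 0)"
        using that by (auto simp: tie_def comb_seq_def)
      obtain j where "j < i" "level (\<omega>' 0) = level (\<omega> j)"
        using *(1) by auto
      then have "level (\<omega>' 0) \<in> (\<lambda>j. level (\<omega> j)) ` {..<i}"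
        by (intro image_eqI[of _ _ j]) simp_all
      with *(2) have "k = level (\<omega>' 0)"
        unfolding k_def by (intro Max_eqI) auto
      with * show ?thesis by simp
    qed
    show ?thesis
    proof (cases "i \<le> k")
      case True
      have "emeasure steps {\<omega>' \<in> space steps. comb_seq i \<omega> \<omega>' \<in> {\<omega> \<in> space steps. tie i \<omega>}} \<le>
          emeasure steps {\<omega>' \<in> space steps. \<omega>' 0 \<in> {g. level g = k}}"
      proof (rule emeasure_mono)
        show "{\<omega>' \<in> space steps. \<omega>' 0 \<in> {g. level g = k}} \<in> sets steps"
          by simp
      qed (use sub in auto)
      also have "\<dots> = ennreal (measure (measure_pmf nu) {g. level g = k})"
        unfolding steps.P.emeasure_eq_measure measure_step ..
      also have "\<dots> \<le> ennreal (real k powr (-5/4) / K_const + (1/2) ^ k)"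
        using True assms by (intro ennreal_leI prob_level_eq) simp
      also have "\<dots> \<le> ennreal ?B"
        using True assms K_const_pos
        by (intro ennreal_leI add_mono divide_right_mono powr_mono2' power_decreasing) auto
      finally show ?thesis .
    next
      case False
      then have "{\<omega>' \<in> space steps. comb_seq i \<omega> \<omega>' \<in> {\<omega> \<in> space steps. tie i \<omega>}} = {}"
        using sub by auto
      then show ?thesis by (simp only: emeasure_empty zero_le)
    qed
  qed
  have "emeasure steps {\<omega> \<in> space steps. tie i \<omega>} \<le> (\<integral>\<^sup>+\<omega>. ennreal ?B \<partial>steps)"
    unfolding emeasure_steps_split[OF bad_events(2), of i i] by (intro nn_integral_mono inner)
  also have "\<dots> = ennreal ?B"
    by (simp add: steps.P.emeasure_space_1)
  finally show ?thesis
    using B by (simp add: steps.P.emeasure_eq_measure)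
qed

lemma AE_not_tie: "AE \<omega> in steps. \<forall>\<^sub>F i in sequentially. \<not> tie i \<omega>"
proof -
  have "summable (\<lambda>i. real i powr (-5/4) / K_const + (1/2 :: real) ^ i)"
    by (intro summable_add summable_divide summable_geometric) (simp_all add: summable_real_powr_iff)
  then have "summable (\<lambda>i. measure steps {\<omega> \<in> space steps. tie i \<omega>})"
    using prob_tie by (rule_tac summable_comparison_test'[of _ 1]) auto
  then have "AE \<omega> in steps. \<forall>\<^sub>F i in sequentially. \<omega> \<in> space steps - {\<omega> \<in> space steps. tie i \<omega>}"
    by (intro borel_cantelli_AE1 bad_events) (auto simp: less_top[symmetric])
  then show ?thesis
    by (auto elim!: eventually_mono)
qed

lemma AE_good: "AE \<omega> in steps. \<exists>N. good_from (path \<omega>) N"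
  using AE_not_low AE_not_tie AE_not_red_record AE_space
proof eventually_elim
  case (elim \<omega>)
  then have "\<forall>\<^sub>F i in sequentially. \<not> low i \<omega> \<and> \<not> tie i \<omega> \<and> \<not> red_record i \<omega>"
    by (auto intro: eventually_conj)
  then obtain N where "\<And>i. N \<le> i \<Longrightarrow> \<not> low i \<omega> \<and> \<not> tie i \<omega> \<and> \<not> red_record i \<omega>"
    by (auto simp: eventually_sequentially)
  then obtain M where "\<forall>i>M. \<exists>m. peak \<omega> i m"
    using eventual_peaks by blast
  then have "good_from (path \<omega>) M"
    unfolding path_def using elim(4) by (intro peaks_imp_good) (auto simp: in_space_steps)
  then show ?case ..
qed

section \<open>Tail events are determined by the boundary map\<close>

text \<open>Along \<open>\<tau>\<close> the conditional probabilities of \<open>T\<close> converge to \<open>1\<close> on \<open>T\<close> and to \<open>0\<close> off \<open>T\<close>; the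
  threshold \<open>1/2\<close> separates the two cases.\<close>

definition recovered :: "(nat \<Rightarrow> 'a) set \<Rightarrow> (nat \<Rightarrow> 'a) set" where
  "recovered T = {s \<in> space path_algebra. \<forall>\<^sub>F k in sequentially. 1/2 < tail_prob T 0 (s k)}"

lemma recovered_measurable: "recovered T \<in> sets path_algebra"
proof -
  define large where "large k s \<longleftrightarrow> 1/2 < tail_prob T 0 (s (Suc k))" for k :: nat and s :: "nat \<Rightarrow> 'a"
  have "(\<lambda>s. s (Suc k)) \<in> path_algebra \<rightarrow>\<^sub>M count_space (carrier G)" for k
    unfolding path_algebra_def by (rule measurable_component_singleton) simp
  from measurable_compose[OF this, of "\<lambda>g. 1/2 < tail_prob T 0 g"]
  have [measurable]: "Measurable.pred path_algebra (large k)" for k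
    unfolding large_def by simp
  have "(\<forall>\<^sub>F k in sequentially. 1/2 < tail_prob T 0 (s k)) \<longleftrightarrow> (\<exists>K. \<forall>k. large (K + k) s)" for s
  proof -
    have "(\<forall>\<^sub>F k in sequentially. 1/2 < tail_prob T 0 (s k)) \<longleftrightarrow>
        (\<forall>\<^sub>F k in sequentially. large k s)"
      unfolding large_def by (rule eventually_sequentially_Suc[symmetric])
    then show ?thesis
      unfolding eventually_sequentially by (metis le_add1 le_Suc_ex)
  qed
  then have "recovered T = {s \<in> space path_algebra. \<exists>K. \<forall>k. large (K + k) s}"
    by (simp add: recovered_def)
  also have "\<dots> \<in> sets path_algebra"
    by measurable
  finally show ?thesis .
qed

lemma eventually_along_tau:
  assumes "z \<in> space path_algebra" "good_from z N" "\<forall>\<^sub>F i in sequentially. P (z i)"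
  shows "\<forall>\<^sub>F k in sequentially. P (tau z k)"
proof -
  obtain i\<^sub>0 where i\<^sub>0: "\<And>i. i\<^sub>0 \<le> i \<Longrightarrow> P (z i)"
    using assms(3) by (auto simp: eventually_sequentially)
  have "N < max i\<^sub>0 (Suc N)"
    by simp
  from tau_entries_are_positions[OF assms(1,2) this]
  obtain k\<^sub>0 where k\<^sub>0: "\<forall>k\<ge>k\<^sub>0. \<exists>i\<ge>max i\<^sub>0 (Suc N). tau z k = z i" ..
  have "P (tau z k)" if "k\<^sub>0 \<le> k" for k
  proof -
    from k\<^sub>0[rule_format, OF that]
    obtain i where "max i\<^sub>0 (Suc N) \<le> i \<and> tau z k = z i" ..
    then show ?thesis
      using i\<^sub>0[of i] by simp
  qed
  then show ?thesis
    by (auto simp: eventually_sequentially)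
qed

lemma tail_event_recovered:
  assumes T: "T \<in> tail_algebra"
  shows "AE z in mu. tau z \<in> recovered T \<longleftrightarrow> z \<in> T"
proof -
  have R: "{z \<in> space path_algebra. tau z \<in> recovered T} \<in> sets path_algebra"
    using measurable_sets[OF measurable_tau recovered_measurable[of T]]
    by (simp add: vimage_def Int_def conj_commute sets_mu space_mu)
  have meas: "{z \<in> space path_algebra. tau z \<in> recovered T \<longleftrightarrow> z \<in> T} \<in> sets path_algebra"
  proof -
    have "{z \<in> space path_algebra. tau z \<in> recovered T \<longleftrightarrow> z \<in> T} =
        space path_algebra - sym_diff {z \<in> space path_algebra. tau z \<in> recovered T} T"
      using sets.sets_into_space[OF tail_in_path_sets[OF T]] by auto
    then show ?thesis
      using R tail_in_path_sets[OF T] by auto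
  qed
  have "AE \<omega> in steps. tau (path \<omega>) \<in> recovered T \<longleftrightarrow> path \<omega> \<in> T"
    using tail_prob_eventually_large[OF T] tail_prob_eventually_large[OF tail_Compl[OF T]] AE_good AE_space
  proof eventually_elim
    case (elim \<omega>)
    then obtain N where N: "good_from (path \<omega>) N"
      by blast
    have z: "path \<omega> \<in> space path_algebra"
      using elim(4) by (rule path_in_space)
    have ev_path: "\<forall>\<^sub>F i in sequentially. P (path \<omega> i)" if "\<forall>\<^sub>F i in sequentially. P (pos \<omega> i)" for P
      using that eventually_ge_at_top[of 1] by eventually_elim (simp add: path_def)
    show ?case
    proof (cases "path \<omega> \<in> T")
      case True
      with elim(1) have "\<forall>\<^sub>F i in sequentially. 1/2 < tail_prob T 0 (pos \<omega> i)"
        by blast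
      then have "\<forall>\<^sub>F k in sequentially. 1/2 < tail_prob T 0 (tau (path \<omega>) k)"
        by (intro eventually_along_tau[OF z N] ev_path)
      then show ?thesis
        using True tau_closed[OF z] by (simp add: recovered_def)
    next
      case False
      with elim(2) z have "\<forall>\<^sub>F i in sequentially. 1/2 < tail_prob (space path_algebra - T) 0 (pos \<omega> i)"
        by blast
      then have "\<forall>\<^sub>F i in sequentially. tail_prob T 0 (pos \<omega> i) < 1/2"
        using tail_prob_Compl[OF T] pos_closed[of \<omega>] elim(4) by (simp add: in_space_steps)
      then have "\<forall>\<^sub>F k in sequentially. tail_prob T 0 (tau (path \<omega>) k) < 1/2"
        by (intro eventually_along_tau[OF z N] ev_path)
      then have "\<not> (\<forall>\<^sub>F k in sequentially. 1/2 < tail_prob T 0 (tau (path \<omega>) k))"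
        using eventually_elim2[where R = "\<lambda>_. False"] by fastforce
      then show ?thesis
        using False by (simp add: recovered_def)
    qed
  qed
  then show ?thesis
    unfolding mu_eq by (subst AE_distr_iff[OF measurable_path meas]) 
qed

lemma tail_equals_tau: "equal_mod_null mu tau_algebra tail_algebra"
  unfolding equal_mod_null_def
proof (intro conjI ballI)
  fix S assume "S \<in> tau_algebra"
  then show "\<exists>T\<in>tail_algebra. sym_diff S T \<in> null_sets mu"
    using tau_algebra_subset_tail by (intro bexI[of _ S]) auto
next
  fix T assume T: "T \<in> tail_algebra"
  let ?S = "tau -` recovered T \<inter> space mu"
  have S: "?S \<in> tau_algebra"
    unfolding tau_algebra_eq using recovered_measurable by blast
  have "?S \<in> sets mu" "T \<in> sets mu"
    using measurable_sets[OF measurable_tau recovered_measurable] tail_in_path_sets[OF T] sets_mu by auto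
  then have D: "sym_diff ?S T \<in> sets mu"
    by auto
  have D_eq: "sym_diff ?S T = {z \<in> space mu. \<not> (tau z \<in> recovered T \<longleftrightarrow> z \<in> T)}"
    using sets.sets_into_space[OF \<open>T \<in> sets mu\<close>] by auto
  have "sym_diff ?S T \<in> null_sets mu"
    using tail_event_recovered[OF T] AE_iff_null[of mu "\<lambda>z. tau z \<in> recovered T \<longleftrightarrow> z \<in> T"] D
    unfolding D_eq by blast
  then show "\<exists>S\<in>tau_algebra. sym_diff S T \<in> null_sets mu"
    using S by blast
qed

end

theorem lemma10:
  fixes G :: "('a, 'm) monoid_scheme"
    and c :: "nat \<Rightarrow> 'a" and F :: "nat \<Rightarrow> 'a set" and b :: "nat \<Rightarrow> 'a"
  assumes "group G"
    and "countable (carrier G)"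
    and "carrier G \<noteq> {\<one>\<^bsub>G\<^esub>}"
    and "amenable_group G"
    and "icc_group G"
    and "lock_construction G c F b"
  shows "equal_mod_null (lock_construction.mu G c F b)
           (lock_construction.tau_algebra G c F b)
           (lock_construction.tail_algebra G c F b)"
  using lock_construction.tail_equals_tau[OF assms(6)] .

end
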